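(* Let $k$ be a field, $R$ a $k$-algebra, and $p\in R$ an element such that $1\notin pR+Rp$. Let $B=B_{++}\cup B_{+-}\cup B_{-+}\cup B_{--}$, where $B_{++}$ is any $k$-basis of $pR\cap Rp$ which, if $p\neq 0$, contains $p$; $B_{+-}$ is any $k$-basis of $pR$ relative to $pR\cap Rp$; $B_{-+}$ is any $k$-basis of $Rp$ relative to $pR\cap Rp$; and $B_{--}$ is any $k$-basis of $R$ relative to $pR+Rp+k$ (so that $B\cup\{1\}$ is a $k$-basis of $R$). Let $$R'=R\langle q\mid pqp=p\rangle$$ be the $k$-algebra obtained by adjoining to $R$ a universal inner inverse $q$ to $p$. Then $R'$ has a $k$-basis given by the set of those words in the generating set $B\cup\{q\}$ that contain no subwords of the form $$xy\quad\text{with } x,y\in B,$$ nor of the form $$(xp)\,q\,(py)\quad\text{with } xp\in B_{++}\cup B_{-+}\text{ and } py\in B_{++}\cup B_{+-}.$$ The reduction to this normal form may be accomplished by the systems of reductions $$xy\ \mapsto\ (xy)_R\quad\text{for all } x,y\in B,$$ and $$(xp)\,q\,(py)\ \mapsto\ (xpy)_R\quad\text{for all } xp\in B_{++}\cup B_{-+},\ py\in B_{++}\cup B_{+-}.$$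
   Context: All rings are associative with unit. If $R$ is a nonzero $k$-algebra, the $k$-subspace of $R$ spanned by $1$ is identified with $k$. An inner inverse of $p$ is an element $q$ with $pqp=p$; $R\langle q\mid pqp=p\rangle$ is the $k$-algebra obtained from $R$ by freely adjoining $q$ subject to $pqp=p$. If $U\subseteq V$ are $k$-vector spaces, a $k$-basis of $V$ relative to $U$ is a subset $B\subseteq V$ such that every element of $V$ can be written uniquely as the sum of an element of $U$ and a $k$-linear combination of elements of $B$. Words and reductions: if an algebra $S$ is generated by a set $G$, a word is a member of the free monoid on $G$ inside the free algebra $k\langle G\rangle$ (the empty word is $1$); an expression for $s\in S$ is an element of $k\langle G\rangle$ mapping to $s$. A family of words gives a $k$-basis of $S$ if it maps one-to-one into $S$ with image a $k$-basis of $S$. A reduction $W\mapsto f$ ($W$ a word, $f\in k\langle G\rangle$) permits replacing any word $uWv$ occurring in an expression by $ufv$. That reduction to a normal form may be accomplished by a system of reductions means that the corresponding relations $W=f$ hold in $S$, and that, starting from any element of $k\langle G\rangle$, repeated application of the reductions terminates at the unique $k$-linear combination of words of the given basis having the same image in $S$. Each element of $B$ is a single letter; an element of $B_{++}\cup B_{-+}$ (which lies in $Rp$) is written $(xp)$ with $x\in R$, and an element of $B_{++}\cup B_{+-}$ (which lies in $pR$) is written $(py)$ with $y\in R$. Here $x,y$ need not be unique, but $xpy\in R$ depends only on the elements $xp$ and $py$. For an expression $f$ representing an element of $R$, $f_R$ denotes the unique $k$-linear combination of elements of $B\cup\{1\}$ giving its value in $R$. *)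

theory Defs
  imports
    "HOL-Library.Poly_Mapping"
    "HOL-Library.Sublist"
    "HOL-Algebra.Algebraic_Closure_Type"
    "Jordan_Normal_Form.Missing_VectorSpace"
begin

section \<open>Algebras over a field and relative bases\<close>

locale k_algebra = vector_space scale
  for scale :: "'k::field \<Rightarrow> 'r::ring_1 \<Rightarrow> 'r" +
  assumes scale_mult_left: "scale c x * y = scale c (x * y)"
    and scale_mult_right: "x * scale c y = scale c (x * y)"

definition is_basis :: "('k::field \<Rightarrow> 'r::ab_group_add \<Rightarrow> 'r) \<Rightarrow> 'r set \<Rightarrow> 'r set \<Rightarrow> bool"
  where "is_basis scale V B \<longleftrightarrow>
    \<not> Modules.module.dependent scale B \<and> Modules.module.span scale B = V"

text \<open>\<open>is_rel_basis scale U V B\<close>: \<open>B\<close> is a basis of \<open>V\<close> relative to \<open>U\<close>. Coefficient families of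
  linear combinations are finitely supported functions.\<close>

definition is_rel_basis ::
  "('k::field \<Rightarrow> 'r::ab_group_add \<Rightarrow> 'r) \<Rightarrow> 'r set \<Rightarrow> 'r set \<Rightarrow> 'r set \<Rightarrow> bool"
  where "is_rel_basis scale U V B \<longleftrightarrow> B \<subseteq> V \<and>
    (\<forall>v\<in>V. \<exists>!d :: 'r \<times> ('r \<Rightarrow>\<^sub>0 'k).
        fst d \<in> U \<and> Poly_Mapping.keys (snd d) \<subseteq> B \<and>
        v = fst d + (\<Sum>b\<in>Poly_Mapping.keys (snd d). scale (Poly_Mapping.lookup (snd d) b) b))"

abbreviation right_mults :: "'r::ring_1 \<Rightarrow> 'r set"
  where "right_mults p \<equiv> {p * x |x. True}"

abbreviation left_mults :: "'r::ring_1 \<Rightarrow> 'r set"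
  where "left_mults p \<equiv> {x * p |x. True}"


section \<open>Free algebras\<close>

text \<open>The free monoid, written additively so that the convolution product of
  \<^theory>\<open>HOL-Library.Poly_Mapping\<close> is the product of the free algebra: the ring
  \<open>'a fmon \<Rightarrow>\<^sub>0 'k\<close> is the free \<open>'k\<close>-algebra on \<open>'a\<close>. The word \<open>0\<close> is the empty word.\<close>

datatype 'a fmon = Word (letters: "'a list")

instantiation fmon :: (type) monoid_add
begin

definition zero_fmon :: "'a fmon" where "zero_fmon = Word []"

definition plus_fmon :: "'a fmon \<Rightarrow> 'a fmon \<Rightarrow> 'a fmon"
  where "plus_fmon u v = Word (letters u @ letters v)"

instance
  by standard (auto simp: zero_fmon_def plus_fmon_def)

end

definition mon :: "'a list \<Rightarrow> 'a fmon \<Rightarrow>\<^sub>0 'k::field"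
  where "mon xs = Poly_Mapping.single (Word xs) 1"

definition scalar :: "'k::field \<Rightarrow> 'a fmon \<Rightarrow>\<^sub>0 'k"
  where "scalar c = Poly_Mapping.single 0 c"

definition words_over :: "'a set \<Rightarrow> 'a fmon set"
  where "words_over G = {w. set (letters w) \<subseteq> G}"

definition eval_at :: "('k::field \<Rightarrow> 'r::ring_1 \<Rightarrow> 'r) \<Rightarrow> ('a \<Rightarrow> 'r) \<Rightarrow> ('a fmon \<Rightarrow>\<^sub>0 'k) \<Rightarrow> 'r"
  where "eval_at scale \<phi> f =
    (\<Sum>w\<in>Poly_Mapping.keys f. scale (Poly_Mapping.lookup f w) (prod_list (map \<phi> (letters w))))"


section \<open>Adjoining a universal inner inverse\<close>

datatype 'r gen = El 'r | Adj

text \<open>The algebra \<open>R\<langle>q | pqp = p\<rangle>\<close> is presented by one generator \<open>El x\<close> for every \<open>x\<close> in \<open>R\<close> and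
  one further generator \<open>Adj\<close>, subject to all relations that hold in \<open>R\<close> and to \<open>pqp = p\<close>.\<close>

definition inner_inverse_relators ::
  "('k::field \<Rightarrow> 'r::ring_1 \<Rightarrow> 'r) \<Rightarrow> 'r \<Rightarrow> ('r gen fmon \<Rightarrow>\<^sub>0 'k) set"
  where "inner_inverse_relators scale p =
      {mon [El (x + y)] - (mon [El x] + mon [El y]) |x y. True}
    \<union> {mon [El (scale c x)] - scalar c * mon [El x] |c x. True}
    \<union> {mon [El (x * y)] - mon [El x, El y] |x y. True}
    \<union> {mon [El 1] - 1}
    \<union> {mon [El p, Adj, El p] - mon [El p]}"

definition inner_inverse_ideal ::
  "('k::field \<Rightarrow> 'r::ring_1 \<Rightarrow> 'r) \<Rightarrow> 'r \<Rightarrow> ('r gen fmon \<Rightarrow>\<^sub>0 'k) set"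
  where "inner_inverse_ideal scale p =
    Idl\<^bsub>ring_of_type_algebra\<^esub> (inner_inverse_relators scale p)"

definition inner_inverse_class ::
  "('k::field \<Rightarrow> 'r::ring_1 \<Rightarrow> 'r) \<Rightarrow> 'r \<Rightarrow> ('r gen fmon \<Rightarrow>\<^sub>0 'k) \<Rightarrow> ('r gen fmon \<Rightarrow>\<^sub>0 'k) set"
  where "inner_inverse_class scale p f =
    inner_inverse_ideal scale p +>\<^bsub>ring_of_type_algebra\<^esub> f"

text \<open>Scalars act through their images in the quotient ring.\<close>

definition inner_inverse_algebra ::
  "('k::field \<Rightarrow> 'r::ring_1 \<Rightarrow> 'r) \<Rightarrow> 'r \<Rightarrow> ('k, ('r gen fmon \<Rightarrow>\<^sub>0 'k) set) module"
  where "inner_inverse_algebra scale p =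
    (let S = ring_of_type_algebra Quot inner_inverse_ideal scale p
     in ring.extend S (module.fields
          (\<lambda>c a. inner_inverse_class scale p (scalar c) \<otimes>\<^bsub>S\<^esub> a)))"


text \<open>The quotient is a \<open>k\<close>-vector space and a ring, and it has the universal property: a homomorphism
  from \<open>R\<close> to a \<open>k\<close>-algebra together with an inner inverse of the image of \<open>p\<close> extends uniquely.\<close>

lemma ring_type_algebra: "ring (ring_of_type_algebra :: 'a::ring_1 ring)"
proof -
  have "\<exists>y. x + y = 0" for x :: 'a
    using add.right_inverse by blast
  thus ?thesis
    unfolding ring_of_type_algebra_def using add.right_inverse
    by unfold_locales (auto simp: algebra_simps Units_def)
qed

lemma type_algebra_simps [simp]:
  "carrier ring_of_type_algebra = UNIV"
  "x \<otimes>\<^bsub>ring_of_type_algebra\<^esub> y = x * y"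
  "x \<oplus>\<^bsub>ring_of_type_algebra\<^esub> y = x + y"
  "\<one>\<^bsub>ring_of_type_algebra\<^esub> = 1"
  "\<zero>\<^bsub>ring_of_type_algebra\<^esub> = 0"
  by (simp_all add: ring_of_type_algebra_def)

lemma inner_inverse_ideal: "ideal (inner_inverse_ideal scale p) ring_of_type_algebra"
  unfolding inner_inverse_ideal_def
  by (rule ring.genideal_ideal[OF ring_type_algebra]) simp

lemma inner_inverse_algebra_sel:
  "carrier (inner_inverse_algebra scale p) =
     carrier (ring_of_type_algebra Quot inner_inverse_ideal scale p)"
  "monoid.mult (inner_inverse_algebra scale p) =
     monoid.mult (ring_of_type_algebra Quot inner_inverse_ideal scale p)"
  "monoid.one (inner_inverse_algebra scale p) =
     monoid.one (ring_of_type_algebra Quot inner_inverse_ideal scale p)"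
  "ring.zero (inner_inverse_algebra scale p) =
     ring.zero (ring_of_type_algebra Quot inner_inverse_ideal scale p)"
  "ring.add (inner_inverse_algebra scale p) =
     ring.add (ring_of_type_algebra Quot inner_inverse_ideal scale p)"
  "c \<odot>\<^bsub>inner_inverse_algebra scale p\<^esub> a = inner_inverse_class scale p (scalar c)
     \<otimes>\<^bsub>ring_of_type_algebra Quot inner_inverse_ideal scale p\<^esub> a"
  by (simp_all add: inner_inverse_algebra_def Let_def ring.defs module.defs)

lemma carrier_inner_inverse_algebra:
  "carrier (inner_inverse_algebra scale p) = range (inner_inverse_class scale p)"
  by (auto simp: inner_inverse_algebra_sel FactRing_def A_RCOSETS_def RCOSETS_def
      inner_inverse_class_def a_r_coset_def)

lemma inner_inverse_class_simps:
  "inner_inverse_class scale p f \<otimes>\<^bsub>inner_inverse_algebra scale p\<^esub> inner_inverse_class scale p g =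
     inner_inverse_class scale p (f * g)"
  "inner_inverse_class scale p f \<oplus>\<^bsub>inner_inverse_algebra scale p\<^esub> inner_inverse_class scale p g =
     inner_inverse_class scale p (f + g)"
  "\<one>\<^bsub>inner_inverse_algebra scale p\<^esub> = inner_inverse_class scale p 1"
  "\<zero>\<^bsub>inner_inverse_algebra scale p\<^esub> = inner_inverse_class scale p 0"
  "c \<odot>\<^bsub>inner_inverse_algebra scale p\<^esub> inner_inverse_class scale p f =
     inner_inverse_class scale p (scalar c * f)"
proof -
  interpret I: ideal "inner_inverse_ideal scale p" ring_of_type_algebra
    by (rule inner_inverse_ideal)
  note hom = I.rcos_ring_hom
  show "inner_inverse_class scale p f \<otimes>\<^bsub>inner_inverse_algebra scale p\<^esub> inner_inverse_class scale p g =
     inner_inverse_class scale p (f * g)" for f g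
    using ring_hom_mult[OF hom, of f g]
    by (simp add: inner_inverse_class_def inner_inverse_algebra_sel)
  thus "c \<odot>\<^bsub>inner_inverse_algebra scale p\<^esub> inner_inverse_class scale p f =
     inner_inverse_class scale p (scalar c * f)"
    by (simp add: inner_inverse_algebra_sel)
  show "inner_inverse_class scale p f \<oplus>\<^bsub>inner_inverse_algebra scale p\<^esub> inner_inverse_class scale p g =
     inner_inverse_class scale p (f + g)"
    using ring_hom_add[OF hom, of f g]
    by (simp add: inner_inverse_class_def inner_inverse_algebra_sel)
  show "\<one>\<^bsub>inner_inverse_algebra scale p\<^esub> = inner_inverse_class scale p 1"
    using ring_hom_one[OF hom]
    by (simp add: inner_inverse_class_def inner_inverse_algebra_sel)
  show "\<zero>\<^bsub>inner_inverse_algebra scale p\<^esub> = inner_inverse_class scale p 0"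
    by (simp add: inner_inverse_class_def inner_inverse_algebra_sel FactRing_def a_r_coset_def')
qed

lemma scalar_simps:
  "scalar (a + b) = scalar a + scalar b" "scalar (a * b) = scalar a * scalar b" "scalar 1 = 1"
  by (simp_all add: scalar_def single_add mult_single)

lemma ring_inner_inverse_algebra: "ring (inner_inverse_algebra scale p)"
proof (intro ringI abelian_groupI Group.monoidI)
  fix x assume "x \<in> carrier (inner_inverse_algebra scale p)"
  then obtain f where "x = inner_inverse_class scale p f"
    by (auto simp: carrier_inner_inverse_algebra)
  hence "inner_inverse_class scale p (-f) \<oplus>\<^bsub>inner_inverse_algebra scale p\<^esub> x =
      \<zero>\<^bsub>inner_inverse_algebra scale p\<^esub>"
    by (simp add: inner_inverse_class_simps)
  thus "\<exists>y\<in>carrier (inner_inverse_algebra scale p).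
      y \<oplus>\<^bsub>inner_inverse_algebra scale p\<^esub> x = \<zero>\<^bsub>inner_inverse_algebra scale p\<^esub>"
    by (auto simp: carrier_inner_inverse_algebra)
qed (auto simp: carrier_inner_inverse_algebra inner_inverse_class_simps algebra_simps)

lemma vectorspace_inner_inverse_algebra:
  "vectorspace ring_of_type_algebra (inner_inverse_algebra scale p)"
proof -
  interpret A: ring "inner_inverse_algebra scale p"
    by (rule ring_inner_inverse_algebra)
  have "module ring_of_type_algebra (inner_inverse_algebra scale p)"
    by (rule module.intro[OF cring_from_type_algebra A.abelian_group_axioms])
       (unfold_locales, auto simp: carrier_inner_inverse_algebra inner_inverse_class_simps
         scalar_simps algebra_simps)
  thus ?thesis
    by (intro vectorspace.intro field_from_type_algebra)
qed

lemma inner_inverse_class_eq_iff: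
  "inner_inverse_class scale p f = inner_inverse_class scale p g \<longleftrightarrow>
    f - g \<in> inner_inverse_ideal scale p"
proof -
  interpret I: ideal "inner_inverse_ideal scale p" ring_of_type_algebra
    by (rule inner_inverse_ideal)
  have class_eq: "inner_inverse_class scale p f = (\<lambda>h. h + f) ` inner_inverse_ideal scale p" for f
    by (auto simp: inner_inverse_class_def a_r_coset_def')
  have add: "a + b \<in> inner_inverse_ideal scale p"
    if "a \<in> inner_inverse_ideal scale p" "b \<in> inner_inverse_ideal scale p" for a b
    using additive_subgroup.a_closed[OF I.additive_subgroup_axioms that] by simp
  have zero: "0 \<in> inner_inverse_ideal scale p"
    using additive_subgroup.zero_closed[OF I.additive_subgroup_axioms] by simp
  have minus: "- a \<in> inner_inverse_ideal scale p" if "a \<in> inner_inverse_ideal scale p" for a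
    using I.I_l_closed[OF that, of "- 1"] by simp
  have sub: "inner_inverse_class scale p f \<subseteq> inner_inverse_class scale p g"
    if "f - g \<in> inner_inverse_ideal scale p" for f g
  proof
    fix x assume "x \<in> inner_inverse_class scale p f"
    then obtain h where h: "h \<in> inner_inverse_ideal scale p" "x = h + f"
      by (auto simp: class_eq)
    hence "x = (h + (f - g)) + g" by simp
    with add[OF h(1) that] show "x \<in> inner_inverse_class scale p g"
      unfolding class_eq by blast
  qed
  show ?thesis
  proof
    assume "inner_inverse_class scale p f = inner_inverse_class scale p g"
    moreover have "f \<in> inner_inverse_class scale p f"
      unfolding class_eq using zero by (auto intro: image_eqI[of _ _ 0])
    ultimately show "f - g \<in> inner_inverse_ideal scale p"
      by (auto simp: class_eq)
  next
    assume *: "f - g \<in> inner_inverse_ideal scale p"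
    moreover have "g - f \<in> inner_inverse_ideal scale p"
      using minus[OF *] by simp
    ultimately show "inner_inverse_class scale p f = inner_inverse_class scale p g"
      using sub by blast
  qed
qed

lemma inner_inverse_relators_class:
  "inner_inverse_class scale p (mon [El (x + y)]) =
     inner_inverse_class scale p (mon [El x] + mon [El y])"
  "inner_inverse_class scale p (mon [El (scale c x)]) =
     inner_inverse_class scale p (scalar c * mon [El x])"
  "inner_inverse_class scale p (mon [El (x * y)]) = inner_inverse_class scale p (mon [El x, El y])"
  "inner_inverse_class scale p (mon [El 1]) = inner_inverse_class scale p 1"
  "inner_inverse_class scale p (mon [El p, Adj, El p]) = inner_inverse_class scale p (mon [El p])"
proof -
  have *: "inner_inverse_relators scale p \<subseteq> inner_inverse_ideal scale p"
    unfolding inner_inverse_ideal_def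
    by (rule ring.genideal_self[OF ring_type_algebra]) simp
  show
    "inner_inverse_class scale p (mon [El (x + y)]) =
       inner_inverse_class scale p (mon [El x] + mon [El y])"
    "inner_inverse_class scale p (mon [El (scale c x)]) =
       inner_inverse_class scale p (scalar c * mon [El x])"
    "inner_inverse_class scale p (mon [El (x * y)]) = inner_inverse_class scale p (mon [El x, El y])"
    "inner_inverse_class scale p (mon [El 1]) = inner_inverse_class scale p 1"
    "inner_inverse_class scale p (mon [El p, Adj, El p]) = inner_inverse_class scale p (mon [El p])"
    unfolding inner_inverse_class_eq_iff
    by (rule subsetD[OF *], unfold inner_inverse_relators_def, blast)+
qed

lemma eval_at_alt:
  assumes "k_algebra scale" "finite A" "Poly_Mapping.keys f \<subseteq> A"
  shows "eval_at scale \<phi> f =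
    (\<Sum>w\<in>A. scale (Poly_Mapping.lookup f w) (prod_list (map \<phi> (letters w))))"
proof -
  interpret k_algebra scale by fact
  show ?thesis
    unfolding eval_at_def using assms(2,3)
    by (intro sum.mono_neutral_left) (auto simp: in_keys_iff)
qed

lemma eval_at_add:
  assumes "k_algebra scale"
  shows "eval_at scale \<phi> (f + g) = eval_at scale \<phi> f + eval_at scale \<phi> g"
proof -
  interpret k_algebra scale by fact
  have "Poly_Mapping.keys (f + g) \<subseteq> Poly_Mapping.keys f \<union> Poly_Mapping.keys g"
    by (rule Poly_Mapping.keys_add)
  thus ?thesis
    by (simp add: eval_at_alt[OF assms, where A = "Poly_Mapping.keys f \<union> Poly_Mapping.keys g"]
        lookup_add scale_left_distrib sum.distrib)
qed

lemma eval_at_single: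
  assumes "k_algebra scale"
  shows "eval_at scale \<phi> (Poly_Mapping.single w c) = scale c (prod_list (map \<phi> (letters w)))"
proof -
  interpret k_algebra scale by fact
  show ?thesis by (simp add: eval_at_def)
qed

lemma sum_single_lookup:
  "(\<Sum>w\<in>Poly_Mapping.keys f. Poly_Mapping.single w (Poly_Mapping.lookup f w)) = f"
  by (rule poly_mapping_eqI) (simp add: lookup_sum lookup_single when_def in_keys_iff)

lemma free_algebra_induct [case_names single add]:
  assumes "\<And>w c. P (Poly_Mapping.single w c)" "\<And>f g. P f \<Longrightarrow> P g \<Longrightarrow> P (f + g)"
  shows "P (f :: 'a fmon \<Rightarrow>\<^sub>0 'k::field)"
proof -
  have "P (\<Sum>w\<in>A. Poly_Mapping.single w (Poly_Mapping.lookup f w))" if "finite A" for A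
    using that
  proof induction
    case empty
    show ?case using assms(1)[of 0 0] by simp
  qed (use assms in auto)
  from this[OF finite_keys[of f]] show ?thesis
    by (simp add: sum_single_lookup)
qed

lemma eval_at_mult:
  assumes "k_algebra scale"
  shows "eval_at scale \<phi> (f * g) = eval_at scale \<phi> f * eval_at scale \<phi> g"
proof (induction f rule: free_algebra_induct)
  case (single w c)
  interpret k_algebra scale by fact
  show ?case
    by (induction g rule: free_algebra_induct)
       (simp_all add: mult_single eval_at_single[OF assms] eval_at_add[OF assms] plus_fmon_def
         scale_mult_left scale_mult_right distrib_left)
qed (simp add: eval_at_add[OF assms] distrib_right)

lemma inner_inverse_universal_exists:
  fixes scale :: "'k::field \<Rightarrow> 'r::ring_1 \<Rightarrow> 'r" and scale' :: "'k \<Rightarrow> 's::ring_1 \<Rightarrow> 's"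
  assumes "k_algebra scale'"
    and \<phi>: "\<And>x y. \<phi> (x + y) = \<phi> x + \<phi> y" "\<And>x y. \<phi> (x * y) = \<phi> x * \<phi> y" "\<phi> 1 = 1"
      "\<And>c x. \<phi> (scale c x) = scale' c (\<phi> x)"
    and s: "\<phi> p * s * \<phi> p = \<phi> p"
  shows "\<exists>\<psi>\<in>ring_hom (inner_inverse_algebra scale p) ring_of_type_algebra.
    (\<forall>c f. \<psi> (inner_inverse_class scale p (scalar c * f)) =
           scale' c (\<psi> (inner_inverse_class scale p f))) \<and>
    (\<forall>x. \<psi> (inner_inverse_class scale p (mon [El x])) = \<phi> x) \<and>
    \<psi> (inner_inverse_class scale p (mon [Adj])) = s"
proof -
  interpret S: k_algebra scale' by fact
  define ev where "ev = eval_at scale' (case_gen \<phi> s)"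
  have ev_add: "ev (f + g) = ev f + ev g" and ev_mult: "ev (f * g) = ev f * ev g" for f g
    by (simp_all add: ev_def eval_at_add[OF assms(1)] eval_at_mult[OF assms(1)])
  have ev_diff: "ev (f - g) = ev f - ev g" for f g
    using ev_add[of "f - g" g] by (simp add: algebra_simps)
  have ev_mon: "ev (mon xs) = prod_list (map (case_gen \<phi> s) xs)" for xs
    by (simp add: ev_def mon_def eval_at_single[OF assms(1)])
  have ev_scalar: "ev (scalar c) = scale' c 1" for c
    by (simp add: ev_def scalar_def zero_fmon_def eval_at_single[OF assms(1)])
  have ev_1: "ev 1 = 1"
    using ev_scalar[of 1] by (simp add: scalar_simps)
  have "ring_hom_ring ring_of_type_algebra ring_of_type_algebra ev"
    by (intro ring_hom_ringI ring_type_algebra) (auto simp: ev_add ev_mult ev_1)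
  from ring_hom_ring.kernel_is_ideal[OF this] have "ideal {f. ev f = 0} ring_of_type_algebra"
    by (simp add: a_kernel_def')
  moreover have "inner_inverse_relators scale p \<subseteq> {f. ev f = 0}"
    using \<phi> s by (auto simp: inner_inverse_relators_def ev_diff ev_add ev_mult ev_mon ev_scalar ev_1
        S.scale_mult_left mult.assoc)
  ultimately have "inner_inverse_ideal scale p \<subseteq> {f. ev f = 0}"
    unfolding inner_inverse_ideal_def by (rule ring.genideal_minimal[OF ring_type_algebra])
  hence ker: "ev f = 0" if "f \<in> inner_inverse_ideal scale p" for f using that by blast
  define \<psi> where "\<psi> = (\<lambda>a. ev (SOME f. a = inner_inverse_class scale p f))"
  have \<psi>: "\<psi> (inner_inverse_class scale p f) = ev f" for f
  proof -
    have "inner_inverse_class scale p f =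
        inner_inverse_class scale p (SOME g. inner_inverse_class scale p f = inner_inverse_class scale p g)"
      by (rule someI) (rule refl)
    thus ?thesis
      unfolding \<psi>_def inner_inverse_class_eq_iff[of scale p f] using ker ev_diff by fastforce
  qed
  show ?thesis
  proof (intro bexI[of _ \<psi>] conjI allI)
    show "\<psi> \<in> ring_hom (inner_inverse_algebra scale p) ring_of_type_algebra"
      by (rule ring_hom_memI)
         (auto simp: carrier_inner_inverse_algebra inner_inverse_class_simps \<psi> ev_add ev_mult ev_1)
  qed (simp_all add: \<psi> ev_mon ev_mult ev_scalar S.scale_mult_left)
qed

lemma inner_inverse_universal_unique:
  fixes scale :: "'k::field \<Rightarrow> 'r::ring_1 \<Rightarrow> 'r"
  assumes "\<psi> \<in> ring_hom (inner_inverse_algebra scale p) T"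
    and "\<psi>' \<in> ring_hom (inner_inverse_algebra scale p) T"
    and El: "\<And>x. \<psi> (inner_inverse_class scale p (mon [El x])) =
                 \<psi>' (inner_inverse_class scale p (mon [El x]))"
    and Adj: "\<psi> (inner_inverse_class scale p (mon [Adj])) =
              \<psi>' (inner_inverse_class scale p (mon [Adj]))"
    and "a \<in> carrier (inner_inverse_algebra scale p)"
  shows "\<psi> a = \<psi>' a"
proof -
  let ?c = "inner_inverse_class scale p"
  have carrier: "?c f \<in> carrier (inner_inverse_algebra scale p)" for f
    by (simp add: carrier_inner_inverse_algebra)
  have add: "\<psi> (?c (f + g)) = \<psi>' (?c (f + g))"
    if "\<psi> (?c f) = \<psi>' (?c f)" "\<psi> (?c g) = \<psi>' (?c g)" for f g
    using that ring_hom_add[OF assms(1) carrier carrier, of f g]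
      ring_hom_add[OF assms(2) carrier carrier, of f g]
    by (simp add: inner_inverse_class_simps)
  have mult: "\<psi> (?c (f * g)) = \<psi>' (?c (f * g))"
    if "\<psi> (?c f) = \<psi>' (?c f)" "\<psi> (?c g) = \<psi>' (?c g)" for f g
    using that ring_hom_mult[OF assms(1) carrier carrier, of f g]
      ring_hom_mult[OF assms(2) carrier carrier, of f g]
    by (simp add: inner_inverse_class_simps)
  have scalar: "\<psi> (?c (scalar c)) = \<psi>' (?c (scalar c))" for c
  proof -
    have "?c (scalar c) = ?c (scalar c) \<otimes>\<^bsub>inner_inverse_algebra scale p\<^esub> ?c 1"
      by (simp add: inner_inverse_class_simps)
    also have "?c 1 = ?c (mon [El 1])"
      by (simp add: inner_inverse_relators_class)
    also have "?c (scalar c) \<otimes>\<^bsub>inner_inverse_algebra scale p\<^esub> ?c (mon [El 1]) =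
        ?c (mon [El (scale c 1)])"
      by (simp add: inner_inverse_class_simps inner_inverse_relators_class(2))
    finally show ?thesis using El by simp
  qed
  have mon: "\<psi> (?c (mon xs)) = \<psi>' (?c (mon xs))" for xs
  proof (induction xs)
    case Nil
    have "mon [] = (scalar 1 :: 'r gen fmon \<Rightarrow>\<^sub>0 'k)"
      by (simp add: mon_def scalar_def zero_fmon_def)
    thus ?case using scalar by simp
  next
    case (Cons x xs)
    have "mon (x # xs) = (mon [x] * mon xs :: 'r gen fmon \<Rightarrow>\<^sub>0 'k)"
      by (simp add: mon_def mult_single plus_fmon_def)
    moreover have "\<psi> (?c (mon [x])) = \<psi>' (?c (mon [x]))"
      using El Adj by (cases x) auto
    ultimately show ?case using mult Cons.IH by simp
  qed
  have "\<psi> (?c f) = \<psi>' (?c f)" for f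
  proof (induction f rule: free_algebra_induct)
    case (single w c)
    have "Poly_Mapping.single w c = scalar c * mon (letters w)"
      by (simp add: mon_def scalar_def mult_single)
    thus ?case using mult scalar mon by simp
  qed (rule add)
  thus ?thesis using assms(5) by (auto simp: carrier_inner_inverse_algebra)
qed


section \<open>Normal words and reductions\<close>

definition gives_basis ::
  "('k::field, 's) module \<Rightarrow> (('a fmon \<Rightarrow>\<^sub>0 'k) \<Rightarrow> 's) \<Rightarrow> 'a fmon set \<Rightarrow> bool"
  where "gives_basis S \<pi> N \<longleftrightarrow>
    inj_on (\<lambda>w. \<pi> (Poly_Mapping.single w 1)) N \<and>
    vectorspace.basis ring_of_type_algebra S ((\<lambda>w. \<pi> (Poly_Mapping.single w 1)) ` N)"

text \<open>A pair \<open>(W, f)\<close> stands for the reduction \<open>W \<mapsto> f\<close>.\<close>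

definition reduction_step ::
  "('a fmon \<times> ('a fmon \<Rightarrow>\<^sub>0 'k::field)) set \<Rightarrow> ('a fmon \<Rightarrow>\<^sub>0 'k) \<Rightarrow> ('a fmon \<Rightarrow>\<^sub>0 'k) \<Rightarrow> bool"
  where "reduction_step Red g h \<longleftrightarrow>
    (\<exists>(W, f)\<in>Red. \<exists>u v. u + W + v \<in> Poly_Mapping.keys g \<and>
       (let c = Poly_Mapping.lookup g (u + W + v)
        in h = g - Poly_Mapping.single (u + W + v) c
                 + Poly_Mapping.single u c * f * Poly_Mapping.single v 1))"

text \<open>\<open>reduces_to_normal_form G N \<pi> Red\<close>: every \<open>W \<mapsto> f\<close> in \<open>Red\<close> is a relation in the algebra onto
  which \<open>\<pi>\<close> maps, and from every element of the free algebra on \<open>G\<close>, every way of repeatedly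
  applying reductions stops, and stops at the unique linear combination of words in \<open>N\<close> with
  the same image.\<close>

definition reduces_to_normal_form ::
  "'a set \<Rightarrow> 'a fmon set \<Rightarrow> (('a fmon \<Rightarrow>\<^sub>0 'k::field) \<Rightarrow> 's) \<Rightarrow>
    ('a fmon \<times> ('a fmon \<Rightarrow>\<^sub>0 'k)) set \<Rightarrow> bool"
  where "reduces_to_normal_form G N \<pi> Red \<longleftrightarrow>
    (\<forall>(W, f)\<in>Red. W \<in> words_over G \<and> Poly_Mapping.keys f \<subseteq> words_over G \<and>
       \<pi> (Poly_Mapping.single W 1) = \<pi> f) \<and>
    (\<forall>g. Poly_Mapping.keys g \<subseteq> words_over G \<longrightarrow>
       (\<exists>!h. Poly_Mapping.keys h \<subseteq> N \<and> \<pi> h = \<pi> g) \<and>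
       \<not> (\<exists>s. s 0 = g \<and> (\<forall>i::nat. reduction_step Red (s i) (s (Suc i)))) \<and>
       (\<forall>h. (reduction_step Red)\<^sup>*\<^sup>* g h \<and> \<not> (\<exists>h'. reduction_step Red h h') \<longrightarrow>
          Poly_Mapping.keys h \<subseteq> N \<and> \<pi> h = \<pi> g))"

text \<open>\<open>R_form scale B r\<close> is the expression \<open>f\<^sub>R\<close> for the value \<open>r\<close> of \<open>f\<close> in \<open>R\<close>. The value given to
  \<open>Adj\<close> is immaterial, since \<open>Adj\<close> does not occur in linear combinations of \<open>B \<union> {1}\<close>.\<close>

definition R_form ::
  "('k::field \<Rightarrow> 'r::ring_1 \<Rightarrow> 'r) \<Rightarrow> 'r set \<Rightarrow> 'r \<Rightarrow> ('r gen fmon \<Rightarrow>\<^sub>0 'k)"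
  where "R_form scale B r =
    (THE f. Poly_Mapping.keys f \<subseteq> insert 0 ((\<lambda>b. Word [El b]) ` B) \<and>
            eval_at scale (case_gen (\<lambda>x. x) 0) f = r)"

text \<open>In the following two definitions \<open>L\<close> is the set of basis elements written \<open>xp\<close>, and \<open>M\<close> the
  set of basis elements written \<open>py\<close>.\<close>

definition normal_words :: "'r set \<Rightarrow> 'r set \<Rightarrow> 'r set \<Rightarrow> 'r gen fmon set"
  where "normal_words B L M = {w \<in> words_over (El ` B \<union> {Adj}).
    (\<forall>x\<in>B. \<forall>y\<in>B. \<not> sublist [El x, El y] (letters w)) \<and>
    (\<forall>u\<in>L. \<forall>v\<in>M. \<not> sublist [El u, Adj, El v] (letters w))}"

definition inner_inverse_reductions ::
  "('k::field \<Rightarrow> 'r::ring_1 \<Rightarrow> 'r) \<Rightarrow> 'r \<Rightarrow> 'r set \<Rightarrow> 'r set \<Rightarrow> 'r set \<Rightarrow>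
    ('r gen fmon \<times> ('r gen fmon \<Rightarrow>\<^sub>0 'k)) set"
  where "inner_inverse_reductions scale p B L M =
      {(Word [El x, El y], R_form scale B (x * y)) |x y. x \<in> B \<and> y \<in> B}
    \<union> {(Word [El (x * p), Adj, El (p * y)], R_form scale B (x * p * y)) |x y.
         x * p \<in> L \<and> p * y \<in> M}"

end

theory Submission
  imports Defs "HOL-Library.Multiset"
begin

text \<open>The normal words \<open>b\<^sub>0 q b\<^sub>1 q \<dots> q b\<^sub>n\<close> with \<open>b\<^sub>i \<in> B \<union> {1}\<close> span the quotient because every
  reduction replaces a word by shorter ones. They are independent because the free vector space \<open>V\<close>
  on them carries an action of the algebra: \<open>q\<close> acts by prefixing, and \<open>x \<in> R\<close> acts by multiplying
  it into \<open>b\<^sub>0\<close>, expanding the product in the basis and, for each resulting \<open>b = zp\<close> in front of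
  \<open>q b\<^sub>1\<close> with \<open>b\<^sub>1 = py\<close>, continuing with \<open>zpy\<close> acting on the rest. The relators act as zero on \<open>V\<close>,
  and a normal word sends the empty word to itself.\<close>

section \<open>Relative bases\<close>

text \<open>The obstacle is that reducing overlapping subwords in different orders might identify
  two normal expressions. The action turns the overlaps into identities between operators: a product
  \<open>x (yp)\<close> meeting \<open>(yp) q (pz)\<close> is behind \<open>gen_act_glue\<close>,
  and a product at the right end of \<open>(yp) q (pz)\<close> is behind
  \<open>inner_inverse_glue\<close>. Confluence is then a consequence: irreducible results are
  normal, they stay in the class they came from, and independence leaves one normal expression per
  class. The shape of the basis makes the action consistent. Whether \<open>b q c\<close> contracts
  is decided letter by letter, and this respects multiplication in \<open>R\<close> because an
  element of \<open>Rp\<close> expands into letters of \<open>L\<close> alone, and an element of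
  \<open>pR\<close> into letters of \<open>M\<close> alone. Since \<open>p\<close> itself is a
  letter, \<open>p q c\<close> contracts for every \<open>c\<close> in \<open>M\<close>, as the
  relator \<open>pqp - p\<close> demands. The hypothesis on \<open>1\<close> keeps it out of
  \<open>L\<close> and \<open>M\<close>, so a freshly prefixed \<open>q\<close>, encoded by a
  leading \<open>1\<close>, contracts with nothing.\<close>

context vector_space
begin

lemma rel_basis_subset: "is_rel_basis scale U V C \<Longrightarrow> C \<subseteq> V"
  by (simp add: is_rel_basis_def)

lemma rel_basis_decompose:
  assumes "is_rel_basis scale U V C" "v \<in> V"
  obtains u w where "u \<in> U" "w \<in> span C" "v = u + w"
proof -
  obtain d where d: "fst d \<in> U" "Poly_Mapping.keys (snd d) \<subseteq> C"
    "v = fst d + (\<Sum>b\<in>Poly_Mapping.keys (snd d). scale (Poly_Mapping.lookup (snd d) b) b)"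
    using assms unfolding is_rel_basis_def by blast
  have "(\<Sum>b\<in>Poly_Mapping.keys (snd d). scale (Poly_Mapping.lookup (snd d) b) b) \<in> span C"
    using d(2) by (intro span_sum span_scale span_base) auto
  thus thesis using that d by blast
qed

text \<open>Zero decomposes as \<open>0 + 0\<close>. A combination lying in \<open>U\<close> gives a
  second decomposition, its negative plus itself, and uniqueness identifies the two.\<close>

lemma rel_basis_coeff_zero:
  assumes C: "is_rel_basis scale U V C" and U: "subspace U" and V: "subspace V"
    and t: "finite t" "t \<subseteq> C" "(\<Sum>b\<in>t. scale (f b) b) \<in> U" and b: "b \<in> t"
  shows "f b = 0"
proof -
  \<comment> \<open>The support of \<open>d\<close> can be smaller than \<open>t\<close>, since
    \<open>f\<close> may vanish on part of \<open>t\<close>.\<close>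
  define d :: "'b \<Rightarrow>\<^sub>0 'a" where "d = (\<Sum>b\<in>t. Poly_Mapping.single b (f b))"
  have lookup: "Poly_Mapping.lookup d b = (if b \<in> t then f b else 0)" for b
    using t(1) by (simp add: d_def lookup_sum lookup_single when_def)
  have keys: "Poly_Mapping.keys d \<subseteq> t"
    by (auto simp: in_keys_iff lookup split: if_splits)
  have "(\<Sum>b\<in>Poly_Mapping.keys d. scale (Poly_Mapping.lookup d b) b) = (\<Sum>b\<in>t. scale (f b) b)"
    by (rule sum.mono_neutral_cong_left) (use t(1) keys in \<open>auto simp: in_keys_iff lookup\<close>)
  hence d0: "0 = - (\<Sum>b\<in>t. scale (f b) b) +
      (\<Sum>b\<in>Poly_Mapping.keys d. scale (Poly_Mapping.lookup d b) b)"
    by simp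
  have "- (\<Sum>b\<in>t. scale (f b) b) \<in> U" using U t(3) by (rule subspace_neg)
  let ?P = "\<lambda>e. fst e \<in> U \<and> Poly_Mapping.keys (snd e) \<subseteq> C \<and>
    0 = fst e + (\<Sum>b\<in>Poly_Mapping.keys (snd e). scale (Poly_Mapping.lookup (snd e) b) b)"
  have "\<exists>!e. ?P e"
    using C subspace_0[OF V] unfolding is_rel_basis_def by blast
  moreover have "?P (- (\<Sum>b\<in>t. scale (f b) b), d)"
    unfolding fst_conv snd_conv
    using d0 \<open>- (\<Sum>b\<in>t. scale (f b) b) \<in> U\<close> keys t(2) by blast
  moreover have "?P (0, 0)" using subspace_0[OF U] by simp
  ultimately have "(- (\<Sum>b\<in>t. scale (f b) b), d) = (0, 0)" by (elim ex1E) (metis (no_types))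
  hence "Poly_Mapping.lookup d b = 0" by simp
  thus ?thesis using b lookup by simp
qed

text \<open>In a vanishing combination the \<open>C\<close> part is the negative of the
  \<open>D\<close> part, so it lies in \<open>V\<close> as well as in \<open>W\<close>, and its
  coefficients vanish by independence relative to \<open>V \<inter> W\<close>. Neither subspace has
  to contain the other, which allows \<open>V = pR\<close> and \<open>W = Rp\<close>.\<close>

lemma independent_Un_rel_basis:
  assumes D: "independent D" "span D = V" and C: "is_rel_basis scale (V \<inter> W) W C"
    and W: "subspace W"
  shows "independent (D \<union> C)"
proof -
  have V: "subspace V" using D(2) by (metis subspace_span)
  have "u v = 0" if t: "finite t" "t \<subseteq> D \<union> C" "(\<Sum>v\<in>t. scale (u v) v) = 0" "v \<in> t" for t u v
  proof -
    have split: "(\<Sum>v\<in>t. scale (u v) v) = (\<Sum>v\<in>t \<inter> C. scale (u v) v) + (\<Sum>v\<in>t - C. scale (u v) v)"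
      using t(1) by (simp add: sum.Int_Diff)
    have "(\<Sum>v\<in>t - C. scale (u v) v) \<in> V"
      unfolding D(2)[symmetric] using t(2) by (intro span_sum span_scale span_base) auto
    from subspace_neg[OF V this] have "(\<Sum>v\<in>t \<inter> C. scale (u v) v) \<in> V"
      using split t(3) by (metis eq_neg_iff_add_eq_0)
    moreover have "(\<Sum>v\<in>t \<inter> C. scale (u v) v) \<in> W"
      using rel_basis_subset[OF C] W by (intro subspace_sum subspace_scale) auto
    ultimately have C0: "u v = 0" if "v \<in> t \<inter> C" for v
      using that t(1) by (intro rel_basis_coeff_zero[OF C subspace_inter[OF V W] W, of "t \<inter> C"]) auto
    show ?thesis
    proof (cases "v \<in> C")
      case False
      have "(\<Sum>v\<in>t - C. scale (u v) v) = 0"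
        using split t(3) C0 by simp
      thus ?thesis
        using independentD[OF D(1), of "t - C" u v] t False by auto
    qed (use C0 t in auto)
  qed
  thus ?thesis unfolding dependent_explicit by blast
qed

lemma rel_basis_extend:
  assumes C: "is_rel_basis scale U V C" and U: "subspace U" and V: "subspace V" and "U \<subseteq> V"
    and D: "independent D" "span D = U"
  shows "independent (D \<union> C)" "span (D \<union> C) = V"
proof -
  have "U \<inter> V = U" using \<open>U \<subseteq> V\<close> by blast
  thus "independent (D \<union> C)"
    using independent_Un_rel_basis[OF D, of V C] C V by simp
  show "span (D \<union> C) = V"
  proof
    show "span (D \<union> C) \<subseteq> V"
      using assms span_superset[of D] rel_basis_subset[OF C] by (intro span_minimal) auto
    show "V \<subseteq> span (D \<union> C)"
    proof
      fix v assume "v \<in> V"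
      then obtain u w where "u \<in> U" "w \<in> span C" "v = u + w"
        by (rule rel_basis_decompose[OF C])
      thus "v \<in> span (D \<union> C)"
        using span_mono[of D "D \<union> C"] span_mono[of C "D \<union> C"] D(2) by (auto intro!: span_add)
    qed
  qed
qed

end

context k_algebra
begin

lemma subspace_left_mults: "subspace (left_mults p)"
proof (rule subspaceI)
  show "0 \<in> left_mults p" by (rule CollectI) (auto intro: exI[of _ 0])
  show "x + y \<in> left_mults p" if "x \<in> left_mults p" "y \<in> left_mults p" for x y
    using that by (auto simp flip: distrib_right)
  show "scale c x \<in> left_mults p" if "x \<in> left_mults p" for c x
    using that by (auto simp flip: scale_mult_left)
qed

lemma subspace_right_mults: "subspace (right_mults p)"
proof (rule subspaceI)
  show "0 \<in> right_mults p" by (rule CollectI) (auto intro: exI[of _ 0])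
  show "x + y \<in> right_mults p" if "x \<in> right_mults p" "y \<in> right_mults p" for x y
    using that by (auto simp flip: distrib_left)
  show "scale c x \<in> right_mults p" if "x \<in> right_mults p" for c x
    using that by (auto simp flip: scale_mult_right)
qed

end

section \<open>The action on words with separators\<close>

abbreviation scl :: "'k::field \<Rightarrow> ('a fmon \<Rightarrow>\<^sub>0 'k) \<Rightarrow> 'a fmon \<Rightarrow>\<^sub>0 'k"
  where "scl \<equiv> \<lambda>c f. scalar c * f"

interpretation free: vector_space scl
  by unfold_locales (simp_all add: scalar_simps algebra_simps)

lemma scalar_mult_single: "scalar c * Poly_Mapping.single w d = Poly_Mapping.single w (c * d)"
  by (simp add: scalar_def mult_single)

lemma single_eq_scl_mon: "Poly_Mapping.single w c = scl c (mon (letters w))"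
  by (simp add: mon_def scalar_mult_single)

lemma keys_scl: "Poly_Mapping.keys (scl c f) \<subseteq> Poly_Mapping.keys f"
proof
  fix w assume "w \<in> Poly_Mapping.keys (scl c f)"
  then obtain u v where "u \<in> Poly_Mapping.keys (scalar c)" "v \<in> Poly_Mapping.keys f" "w = u + v"
    using keys_mult[of "scalar c" f] by blast
  thus "w \<in> Poly_Mapping.keys f" by (simp add: scalar_def split: if_splits)
qed

lemma mon_append: "mon (xs @ ys) = mon xs * mon ys"
  by (simp add: mon_def mult_single plus_fmon_def)

text \<open>The two letter types differ because words in the generators, of type
  \<open>'r gen\<close>, are also sent to vectors over words in \<open>'r\<close>.\<close>

definition lext ::
  "('a list \<Rightarrow> 'b fmon \<Rightarrow>\<^sub>0 'k) \<Rightarrow> ('a fmon \<Rightarrow>\<^sub>0 'k::field) \<Rightarrow> ('b fmon \<Rightarrow>\<^sub>0 'k)"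
  where "lext F f = (\<Sum>w\<in>Poly_Mapping.keys f. scl (Poly_Mapping.lookup f w) (F (letters w)))"

lemma lext_superset:
  assumes "finite A" "Poly_Mapping.keys f \<subseteq> A"
  shows "lext F f = (\<Sum>w\<in>A. scl (Poly_Mapping.lookup f w) (F (letters w)))"
  unfolding lext_def using assms
  by (intro sum.mono_neutral_left) (auto simp: in_keys_iff)

lemma lext_single: "lext F (Poly_Mapping.single w c) = scl c (F (letters w))"
  by (simp add: lext_def)

lemma lext_mon [simp]: "lext F (mon ws) = F ws"
  by (simp add: mon_def lext_single scalar_simps(3))

lemma lext_add: "lext F (f + g) = lext F f + lext F g"
  using Poly_Mapping.keys_add[of f g]
  by (simp add: lext_superset[where A = "Poly_Mapping.keys f \<union> Poly_Mapping.keys g"]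
      lookup_add scalar_simps(1) distrib_right sum.distrib)

lemma lext_scl: "lext F (scl c f) = scl c (lext F f)"
  by (induction f rule: free_algebra_induct)
    (simp_all add: scalar_mult_single lext_single lext_add distrib_left)

lemma linear_lext: "Vector_Spaces.linear scl scl (lext F)"
  by unfold_locales (simp_all add: lext_add lext_scl)

text \<open>This is what the action uses of the four-part basis: one basis of \<open>R\<close>
  containing \<open>1\<close>, with bases \<open>L\<close> of \<open>Rp\<close> and \<open>M\<close>
  of \<open>pR\<close> among its letters. The list encoding lets \<open>1\<close> stand for the
  empty word, so \<open>1\<close> must not be a letter of \<open>B\<close>.\<close>

locale adapted_basis = k_algebra scale
  for scale :: "'k::field \<Rightarrow> 'r::ring_1 \<Rightarrow> 'r" +
  fixes p :: 'r and B L M :: "'r set"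
  assumes independent_basis: "independent (insert 1 B)"
    and span_basis: "span (insert 1 B) = UNIV"
    and one_notin: "1 \<notin> B"
    and L_subset: "L \<subseteq> B" and M_subset: "M \<subseteq> B"
    and span_L: "span L = left_mults p" and span_M: "span M = right_mults p"
    and p_in_L: "p \<noteq> 0 \<Longrightarrow> p \<in> L"
begin

sublocale RV: vector_space_pair scale "scl :: 'k \<Rightarrow> ('r fmon \<Rightarrow>\<^sub>0 'k) \<Rightarrow> _"
  by unfold_locales

sublocale VV: vector_space_pair "scl :: 'k \<Rightarrow> ('r fmon \<Rightarrow>\<^sub>0 'k) \<Rightarrow> _" "scl :: 'k \<Rightarrow> ('r fmon \<Rightarrow>\<^sub>0 'k) \<Rightarrow> _"
  by unfold_locales

text \<open>Any choice gives the same action: if \<open>b = z * p\<close>, then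
  \<open>b * y = z * (p * y)\<close> depends only on \<open>b\<close> and \<open>p * y\<close>. This
  product is the value of \<open>b q c\<close> for \<open>c = p * y\<close>, which
  \<open>glue\<close> uses.\<close>

definition cofactor :: "'r \<Rightarrow> 'r"
  where "cofactor v = (SOME y. v = p * y)"

lemma cofactor: "v \<in> M \<Longrightarrow> p * cofactor v = v"
  using span_M span_base[of v M] unfolding cofactor_def
  by (metis (mono_tags, lifting) mem_Collect_eq someI_ex)

text \<open>The list \<open>[b\<^sub>0, \<dots>, b\<^sub>n]\<close> stands for the word \<open>b\<^sub>0 q b\<^sub>1 q \<dots> q b\<^sub>n\<close>, where a \<open>b\<^sub>i\<close> equal to \<open>1\<close>
  is the empty word, and \<open>glue s r\<close> stands for the element \<open>r q s\<close>.\<close>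

primrec glue :: "'r list \<Rightarrow> 'r \<Rightarrow> 'r fmon \<Rightarrow>\<^sub>0 'k" where
  "glue [] = RV.construct (insert 1 B) (\<lambda>b. mon [b])"
| "glue (c # s) = RV.construct (insert 1 B)
     (\<lambda>b. if b \<in> L \<and> c \<in> M then glue s (b * cofactor c) else mon (b # c # s))"

lemma linear_glue: "Vector_Spaces.linear scale scl (glue s)"
  by (cases s) (simp_all add: RV.linear_construct independent_basis)

declare glue.simps [simp del]

lemma glue_basis:
  assumes "b \<in> insert 1 B"
  shows "glue [] b = mon [b]"
    "glue (c # s) b = (if b \<in> L \<and> c \<in> M then glue s (b * cofactor c) else mon (b # c # s))"
  using RV.construct_basis[OF independent_basis assms] by (simp_all add: glue.simps)

text \<open>The normal words in the list encoding. Products \<open>xy\<close> impose no condition,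
  as consecutive entries are always separated by \<open>q\<close>. The list \<open>[]\<close>
  encodes no word (the empty word is \<open>[1]\<close>); it is kept here so that
  \<open>tails\<close> is closed under dropping the head, and is removed again in
  \<open>vecs\<close>.\<close>

definition tails :: "'r list set"
  where "tails = {s. set s \<subseteq> insert 1 B \<and> successively (\<lambda>b c. \<not> (b \<in> L \<and> c \<in> M)) s}"

lemma tails_Nil [simp]: "[] \<in> tails"
  by (simp add: tails_def)

lemma tails_Cons: "c # s \<in> tails \<longleftrightarrow>
    c \<in> insert 1 B \<and> s \<in> tails \<and> (\<forall>d t. s = d # t \<longrightarrow> \<not> (c \<in> L \<and> d \<in> M))"
  by (cases s) (auto simp: tails_def)

lemma glue_tails: "b # s \<in> tails \<Longrightarrow> glue s b = mon (b # s)"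
  by (cases s) (auto simp: tails_Cons glue_basis)

definition vecs :: "('r fmon \<Rightarrow>\<^sub>0 'k) set"
  where "vecs = free.span (mon ` (tails - {[]}))"

lemma mon_in_vecs: "s \<in> tails \<Longrightarrow> s \<noteq> [] \<Longrightarrow> mon s \<in> vecs"
  unfolding vecs_def by (rule free.span_base) auto

lemma linear_in_vecs:
  assumes "Vector_Spaces.linear scl scl f" "v \<in> vecs"
    and "\<And>b s. b # s \<in> tails \<Longrightarrow> f (mon (b # s)) \<in> vecs"
  shows "f v \<in> vecs"
proof -
  have "f ` vecs \<subseteq> vecs"
    unfolding vecs_def VV.linear_span_image[OF assms(1), symmetric]
  proof (rule free.span_minimal)
    show "f ` mon ` (tails - {[]}) \<subseteq> free.span (mon ` (tails - {[]}))"
      using assms(3) unfolding vecs_def by (auto; metis list.exhaust)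
  qed simp
  thus ?thesis using assms(2) by blast
qed

lemma linear_eq_on_vecs:
  fixes f g :: "('r fmon \<Rightarrow>\<^sub>0 'k) \<Rightarrow> 'r fmon \<Rightarrow>\<^sub>0 'k"
  assumes "Vector_Spaces.linear scl scl f" "Vector_Spaces.linear scl scl g" "v \<in> vecs"
    and "\<And>b s. b # s \<in> tails \<Longrightarrow> f (mon (b # s)) = g (mon (b # s))"
  shows "f v = g v"
  by (rule VV.linear_eq_on[OF assms(1,2) assms(3)[unfolded vecs_def]])
    (use assms(4) in \<open>auto; metis list.exhaust\<close>)

text \<open>A letter that contracts hands over to the shorter list \<open>s\<close>; one that does
  not contract forms a longer list still free of reducible pairs.\<close>

lemma glue_in_vecs: "s \<in> tails \<Longrightarrow> glue s r \<in> vecs"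
proof (induction s arbitrary: r)
  case Nil
  have "glue [] r \<in> free.span ((\<lambda>b. mon [b]) ` insert 1 B)"
    unfolding glue.simps by (rule RV.construct_in_span[OF independent_basis])
  also have "\<dots> \<subseteq> vecs"
    unfolding vecs_def by (rule free.span_mono) (auto simp: tails_Cons)
  finally show ?case .
next
  case (Cons c s)
  have "glue (c # s) r \<in> free.span ((\<lambda>b. if b \<in> L \<and> c \<in> M then glue s (b * cofactor c)
      else mon (b # c # s)) ` insert 1 B)"
    unfolding glue.simps by (rule RV.construct_in_span[OF independent_basis])
  also have "\<dots> \<subseteq> vecs"
    unfolding vecs_def
  proof (rule free.span_minimal)
    show "(\<lambda>b. if b \<in> L \<and> c \<in> M then glue s (b * cofactor c) else mon (b # c # s)) ` insert 1 B
        \<subseteq> free.span (mon ` (tails - {[]}))"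
      using Cons unfolding vecs_def[symmetric]
      by (auto simp: tails_Cons intro!: mon_in_vecs)
  qed simp
  finally show ?case .
qed

section \<open>The generators as operators\<close>

primrec gen_act :: "'r gen \<Rightarrow> ('r fmon \<Rightarrow>\<^sub>0 'k) \<Rightarrow> 'r fmon \<Rightarrow>\<^sub>0 'k" where
  "gen_act (El x) = lext (\<lambda>s. glue (tl s) (x * hd s))"
| "gen_act Adj = lext (\<lambda>s. mon (1 # s))"

lemma linear_gen_act: "Vector_Spaces.linear scl scl (gen_act g)"
  by (cases g) (simp_all add: linear_lext)

lemma one_notin_L: "1 \<notin> L" and one_notin_M: "1 \<notin> M"
  using one_notin L_subset M_subset by auto

text \<open>The leading \<open>1\<close> created by \<open>Adj\<close> forms no reducible pair with
  the next entry because \<open>1\<close> is not in \<open>L\<close>.\<close>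

lemma gen_act_in_vecs: "v \<in> vecs \<Longrightarrow> gen_act g v \<in> vecs"
proof (erule linear_in_vecs[OF linear_gen_act])
  show "gen_act g (mon (b # s)) \<in> vecs" if "b # s \<in> tails" for b s
    using that one_notin_L by (cases g) (auto simp: tails_Cons intro!: glue_in_vecs mon_in_vecs)
qed

lemma linear_mult_left: "Vector_Spaces.linear scale scale ((*) x)"
  by unfold_locales (simp_all add: distrib_left scale_mult_right)

lemma linear_mult_right: "Vector_Spaces.linear scale scale (\<lambda>x. x * y)"
  by unfold_locales (simp_all add: distrib_right scale_mult_left)

lemma mult_in_span_L: "b \<in> L \<Longrightarrow> x * b \<in> span L"
  using span_L span_base[of b L] by (auto simp flip: mult.assoc)

text \<open>Associativity \<open>x (r q s) = (x r) q s\<close>, checked on the letters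
  \<open>b\<close> of \<open>r\<close>. If \<open>b q c\<close> does not contract, it is the
  definition of the action. If it does, both sides are rewritten with the shorter list
  \<open>s\<close>, where the induction hypothesis applies.\<close>

lemma gen_act_glue: "s \<in> tails \<Longrightarrow> gen_act (El x) (glue s r) = glue s (x * r)"
proof (induction s arbitrary: r)
  case Nil
  have "(gen_act (El x) \<circ> glue []) r = (glue [] \<circ> (*) x) r"
  proof (rule RV.linear_eq_on)
    show "r \<in> span (insert 1 B)" by (simp add: span_basis)
    show "(gen_act (El x) \<circ> glue []) b = (glue [] \<circ> (*) x) b" if "b \<in> insert 1 B" for b
      using glue_basis(1)[OF that] by simp
  qed (rule Vector_Spaces.linear_compose[OF linear_glue linear_gen_act]
      Vector_Spaces.linear_compose[OF linear_mult_left linear_glue])+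
  thus ?case by simp
next
  case (Cons c s)
  have "(gen_act (El x) \<circ> glue (c # s)) r = (glue (c # s) \<circ> (*) x) r"
  proof (rule RV.linear_eq_on)
    show "r \<in> span (insert 1 B)" by (simp add: span_basis)
    show "(gen_act (El x) \<circ> glue (c # s)) b = (glue (c # s) \<circ> (*) x) b" if b: "b \<in> insert 1 B" for b
    proof (cases "b \<in> L \<and> c \<in> M")
      case True
      \<comment> \<open>The product \<open>x * b\<close> stays in \<open>Rp\<close>, and on
        \<open>span L\<close> the case distinction of \<open>glue\<close> disappears: every letter
        of \<open>L\<close> takes the contracting branch, so two linear maps agree on a spanning
        set.\<close>
      have "glue (c # s) (x * b) = (glue s \<circ> (\<lambda>x. x * cofactor c)) (x * b)"
      proof (rule RV.linear_eq_on)
        show "x * b \<in> span L" using True by (simp add: mult_in_span_L)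
        show "glue (c # s) d = (glue s \<circ> (\<lambda>x. x * cofactor c)) d" if "d \<in> L" for d
          using that True L_subset by (auto simp: glue_basis)
      qed (rule linear_glue Vector_Spaces.linear_compose[OF linear_mult_right linear_glue])+
      thus ?thesis
        using True Cons b by (simp add: glue_basis tails_Cons mult.assoc)
    next
      case False
      hence "glue (c # s) b = mon (b # c # s)"
        using glue_basis(2)[OF b, of c s] by (simp only: if_False)
      thus ?thesis by simp
    qed
  qed (rule Vector_Spaces.linear_compose[OF linear_glue linear_gen_act]
      Vector_Spaces.linear_compose[OF linear_mult_left linear_glue])+
  thus ?case by simp
qed

text \<open>By linearity \<open>r\<close> may be a letter of \<open>M\<close>. If it stays in front,
  \<open>p q r\<close> contracts back to \<open>r\<close>. If it contracts with the next entry
  \<open>c\<close>, then \<open>r * cofactor c\<close> is again in \<open>pR\<close>, and the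
  induction hypothesis for the shorter list applies.\<close>

lemma inner_inverse_glue:
  assumes "s \<in> tails" "r \<in> right_mults p"
  shows "gen_act (El p) (gen_act Adj (glue s r)) = glue s r"
  using assms
proof (induction s arbitrary: r)
  have step: "gen_act (El p) (gen_act Adj (glue s c)) = glue s c"
    if "glue s c = mon (c # s)" "c \<in> M" for c s
  proof -
    \<comment> \<open>A nonzero multiple \<open>p * y\<close> forces \<open>p\<close> to be nonzero,
      and then \<open>p\<close> is a letter of \<open>L\<close>.\<close>
    have "c \<noteq> 0"
      using that(2) independent_basis M_subset dependent_zero by blast
    hence "p \<in> L" using cofactor[OF that(2)] p_in_L by (metis mult_zero_left)
    thus ?thesis
      using that L_subset by (auto simp: glue_basis cofactor)
  qed
  have extend: "gen_act (El p) (gen_act Adj (glue s r)) = glue s r"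
    if "\<And>c. c \<in> M \<Longrightarrow> gen_act (El p) (gen_act Adj (glue s c)) = glue s c" "r \<in> span M" for s r
  proof -
    have "(gen_act (El p) \<circ> (gen_act Adj \<circ> glue s)) r = glue s r"
      by (rule RV.linear_eq_on[OF _ linear_glue that(2)])
        (use that(1) in \<open>intro Vector_Spaces.linear_compose[OF _ linear_gen_act] linear_glue,
          simp del: gen_act.simps\<close>)
    thus ?thesis by simp
  qed
  {
    case Nil
    thus ?case using M_subset by (intro extend[OF step]) (auto simp: glue_basis span_M)
  next
    case (Cons c s)
    show ?case
    proof (rule extend)
      show "r \<in> span M" using Cons.prems span_M by simp
      fix b assume b: "b \<in> M"
      then obtain y where y: "b = p * y" using cofactor by metis
      show "gen_act (El p) (gen_act Adj (glue (c # s) b)) = glue (c # s) b"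
      proof (cases "b \<in> L \<and> c \<in> M")
        case True
        moreover have "b * cofactor c \<in> right_mults p"
          by (auto simp: y mult.assoc)
        moreover have "s \<in> tails" "b \<in> insert 1 B"
          using Cons.prems(1) b M_subset by (auto simp: tails_Cons)
        ultimately show ?thesis
          using Cons.IH[of "b * cofactor c"] by (simp add: glue_basis del: gen_act.simps)
      next
        case False
        thus ?thesis
          using b M_subset by (intro step) (auto simp: glue_basis)
      qed
    qed
  }
qed

section \<open>The free algebra as operators, and the vanishing of the relators\<close>

definition act :: "('r gen fmon \<Rightarrow>\<^sub>0 'k) \<Rightarrow> ('r fmon \<Rightarrow>\<^sub>0 'k) \<Rightarrow> 'r fmon \<Rightarrow>\<^sub>0 'k"
  where "act f v = lext (\<lambda>ws. foldr gen_act ws v) f"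

lemma act_add: "act (f + g) v = act f v + act g v"
  by (simp add: act_def lext_add)

lemma act_diff: "act (f - g) v = act f v - act g v"
  using act_add[of "f - g" g v] by (simp add: algebra_simps)

lemma act_scl: "act (scl c f) v = scl c (act f v)"
  by (simp add: act_def lext_scl)

lemma act_mon [simp]: "act (mon ws) v = foldr gen_act ws v"
  by (simp add: act_def)

lemma act_1 [simp]: "act 1 v = v"
  using act_mon[of "[]" v] by (simp add: mon_def zero_fmon_def[symmetric])

lemma linear_foldr_gen_act: "Vector_Spaces.linear scl scl (foldr gen_act ws)"
proof (induction ws)
  case (Cons g ws)
  thus ?case using Vector_Spaces.linear_compose[OF Cons linear_gen_act[of g]] by (simp add: comp_def)
qed (simp add: free.linear_id[unfolded id_def])

lemma foldr_gen_act_in_vecs: "v \<in> vecs \<Longrightarrow> foldr gen_act ws v \<in> vecs"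
  by (induction ws) (simp_all add: gen_act_in_vecs del: gen_act.simps)

lemma act_in_vecs: "v \<in> vecs \<Longrightarrow> act f v \<in> vecs"
  unfolding act_def lext_def vecs_def
  by (intro free.span_sum free.span_scale) (simp add: foldr_gen_act_in_vecs flip: vecs_def)

lemma act_add_right: "act f (v + w) = act f v + act f w"
  by (induction f rule: free_algebra_induct)
    (simp_all add: single_eq_scl_mon act_scl act_add VV.linear_add[OF linear_foldr_gen_act] distrib_left)

lemma act_mult: "act (f * g) v = act f (act g v)"
proof (induction f rule: free_algebra_induct)
  case (single u c)
  show ?case
  proof (induction g rule: free_algebra_induct)
    case (single w d)
    show ?case
      by (simp add: mult_single act_def lext_single plus_fmon_def
          VV.linear_scale[OF linear_foldr_gen_act])
  qed (simp add: distrib_left act_add act_add_right)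
qed (simp add: distrib_right act_add)

lemma gen_act_El_add: "v \<in> vecs \<Longrightarrow> gen_act (El (x + y)) v = gen_act (El x) v + gen_act (El y) v"
  by (rule linear_eq_on_vecs[OF linear_gen_act VV.linear_compose_add[OF linear_gen_act linear_gen_act]])
    (simp_all add: distrib_right RV.linear_add[OF linear_glue])

lemma gen_act_El_scale: "v \<in> vecs \<Longrightarrow> gen_act (El (scale c x)) v = scl c (gen_act (El x) v)"
  by (rule linear_eq_on_vecs[OF linear_gen_act VV.linear_compose_scale_right[OF linear_gen_act]])
    (simp_all add: scale_mult_left RV.linear_scale[OF linear_glue])

lemma gen_act_El_mult: "v \<in> vecs \<Longrightarrow> gen_act (El (x * y)) v = gen_act (El x) (gen_act (El y) v)"
proof (rule linear_eq_on_vecs[OF linear_gen_act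
      Vector_Spaces.linear_compose[OF linear_gen_act linear_gen_act, unfolded comp_def]])
  fix b s assume "b # s \<in> tails"
  thus "gen_act (El (x * y)) (mon (b # s)) = gen_act (El x) (gen_act (El y) (mon (b # s)))"
    using gen_act_glue[of s x "y * b"] by (simp add: tails_Cons mult.assoc)
qed

text \<open>The restriction to \<open>vecs\<close> matters: \<open>glue s b\<close> returns
  \<open>b # s\<close> when no pair at the front contracts, and on a list with a reducible front
  pair \<open>El 1\<close> need not act as the identity.\<close>

lemma gen_act_El_one: "v \<in> vecs \<Longrightarrow> gen_act (El 1) v = v"
  by (rule linear_eq_on_vecs[OF linear_gen_act free.linear_id[unfolded id_def]])
    (simp_all add: glue_tails)

text \<open>The first application of \<open>El p\<close> moves the leading factor into
  \<open>pR\<close>, which is the situation of \<open>inner_inverse_glue\<close>.\<close>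

lemma gen_act_inner_inverse:
  "v \<in> vecs \<Longrightarrow> gen_act (El p) (gen_act Adj (gen_act (El p) v)) = gen_act (El p) v"
proof (rule linear_eq_on_vecs[OF Vector_Spaces.linear_compose[OF Vector_Spaces.linear_compose[OF
        linear_gen_act linear_gen_act] linear_gen_act, unfolded comp_def] linear_gen_act])
  fix b s assume "b # s \<in> tails"
  thus "gen_act (El p) (gen_act Adj (gen_act (El p) (mon (b # s)))) = gen_act (El p) (mon (b # s))"
    using inner_inverse_glue[of s "p * b"] by (auto simp: tails_Cons)
qed

text \<open>The annihilator of \<open>vecs\<close> is a two-sided ideal; closure under
  multiplication on the right holds because \<open>vecs\<close> is invariant under the action. It
  contains the relators, hence the ideal they generate.\<close>

lemma act_ideal:
  assumes "f \<in> inner_inverse_ideal scale p" "v \<in> vecs"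
  shows "act f v = 0"
proof -
  let ?J = "{f. \<forall>v\<in>vecs. act f v = 0}"
  have zero: "act 0 v = 0" for v by (simp add: act_def lext_def)
  have minus: "act (- f) v = - act f v" for f v
    using act_diff[of 0 f v] zero by simp
  have right0: "act f 0 = 0" for f
    using act_add_right[of f 0 0] by simp
  have "ideal ?J ring_of_type_algebra"
  proof (rule idealI[OF ring_type_algebra])
    show "subgroup ?J (add_monoid ring_of_type_algebra)"
    proof (rule group.subgroupI)
      show "group (add_monoid (ring_of_type_algebra :: ('r gen fmon \<Rightarrow>\<^sub>0 'k) ring))"
        using ring_type_algebra by (rule abelian_group.a_group[OF ring.is_abelian_group])
      show "?J \<noteq> {}" using zero by blast
      fix a assume a: "a \<in> ?J"
      have "inv\<^bsub>add_monoid ring_of_type_algebra\<^esub> a = - a"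
        using abelian_group.minus_equality[OF ring.is_abelian_group[OF ring_type_algebra], of "- a" a]
        by (simp add: a_inv_def)
      thus "inv\<^bsub>add_monoid ring_of_type_algebra\<^esub> a \<in> ?J" using a by (simp add: minus)
    qed (auto simp: act_add)
  qed (auto simp: act_mult act_in_vecs right0)
  moreover have "inner_inverse_relators scale p \<subseteq> ?J"
    unfolding inner_inverse_relators_def
    by (auto simp: act_diff act_add act_scl gen_act_El_add gen_act_El_scale gen_act_El_mult
      gen_act_El_one gen_act_inner_inverse simp del: gen_act.simps)
  ultimately have "inner_inverse_ideal scale p \<subseteq> ?J"
    unfolding inner_inverse_ideal_def by (rule ring.genideal_minimal[OF ring_type_algebra])
  thus ?thesis using assms by blast
qed

section \<open>Independence of the normal words\<close>

fun word_of :: "'r list \<Rightarrow> 'r gen list" where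
  "word_of [] = []"
| "word_of [b] = (if b = 1 then [] else [El b])"
| "word_of (b # s) = (if b = 1 then [] else [El b]) @ Adj # word_of s"

lemma normal_words_Cons:
  assumes "Word (g # ws) \<in> normal_words B L M"
  shows "Word ws \<in> normal_words B L M"
  using assms unfolding normal_words_def words_over_def
  by (auto simp: sublist_Cons_right)

text \<open>The word is built up from its right end, starting at the empty word
  \<open>mon [1]\<close>. No letter triggers a contraction or a product of two letters, since each
  such event would exhibit an excluded subword.\<close>

lemma normal_word_act:
  assumes "Word ws \<in> normal_words B L M"
  shows "\<exists>s\<in>tails. s \<noteq> [] \<and> word_of s = ws \<and> foldr gen_act ws (mon [1]) = mon s"
  using assms
proof (induction ws)
  case Nil
  show ?case by (rule bexI[of _ "[1]"]) (auto simp: tails_Cons)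
next
  case (Cons g ws)
  obtain s where s: "s \<in> tails" "s \<noteq> []" "word_of s = ws" "foldr gen_act ws (mon [1]) = mon s"
    using Cons.IH[OF normal_words_Cons[OF Cons.prems]] by blast
  then obtain c t where ct: "s = c # t" by (cases s) auto
  show ?case
  proof (cases g)
    case Adj
    show ?thesis
      by (rule bexI[of _ "1 # s"]) (use s Adj one_notin_L ct in \<open>auto simp: tails_Cons\<close>)
  next
    case (El b)
    have b: "b \<in> B"
      using Cons.prems El by (auto simp: normal_words_def words_over_def)
    \<comment> \<open>A leading entry other than \<open>1\<close> is a letter of \<open>B\<close>
      standing directly after \<open>b\<close> in the word, an excluded product.\<close>
    have "c = 1"
    proof (rule ccontr)
      assume "c \<noteq> 1"
      hence "c \<in> B" "\<exists>vs. ws = El c # vs"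
        using s(1,3) unfolding ct by (cases t; auto simp: tails_Cons)+
      hence "sublist [El b, El c] (g # ws)" unfolding El by (auto simp: sublist_def)
      thus False using Cons.prems b \<open>c \<in> B\<close> by (auto simp: normal_words_def)
    qed
    have tails: "b # t \<in> tails"
    proof -
      \<comment> \<open>A reducible pair at the front is an excluded subword \<open>b q d\<close>.
        Since \<open>d\<close> is in \<open>M\<close> it is not \<open>1\<close>, so it does appear
        as a letter.\<close>
      have False if "t = d # u" "b \<in> L" "d \<in> M" for d u
      proof -
        have "\<exists>vs. ws = Adj # El d # vs"
          using s(3) that one_notin_M unfolding ct \<open>c = 1\<close> by (cases u) auto
        hence "sublist [El b, Adj, El d] (g # ws)" unfolding El by (auto simp: sublist_def)
        thus False using Cons.prems that(2,3) by (auto simp: normal_words_def)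
      qed
      thus ?thesis using s(1) b unfolding ct by (auto simp: tails_Cons)
    qed
    moreover have "word_of (b # t) = g # ws"
      using s(3) b one_notin El unfolding ct \<open>c = 1\<close> by (cases t) auto
    moreover have "foldr gen_act (g # ws) (mon [1]) = mon (b # t)"
      using s(4) El tails unfolding ct \<open>c = 1\<close> by (simp add: glue_tails)
    ultimately show ?thesis by blast
  qed
qed

text \<open>Applied to the empty word, \<open>f\<close> becomes a combination of the vectors
  \<open>mon (\<sigma> w)\<close> with the same coefficients. These vectors are distinct because
  \<open>word_of\<close> recovers \<open>w\<close> from \<open>\<sigma> w\<close>, and the sum is
  zero because the ideal annihilates \<open>vecs\<close>.\<close>

lemma normal_words_independent:
  assumes f: "Poly_Mapping.keys f \<subseteq> normal_words B L M" "f \<in> inner_inverse_ideal scale p"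
  shows "f = 0"
proof -
  have "\<forall>w\<in>normal_words B L M. \<exists>s. word_of s = letters w \<and> foldr gen_act (letters w) (mon [1]) = mon s"
    using normal_word_act by (metis fmon.collapse)
  then obtain \<sigma> where \<sigma>: "word_of (\<sigma> w) = letters w" "foldr gen_act (letters w) (mon [1]) = mon (\<sigma> w)"
    if "w \<in> normal_words B L M" for w
    by metis
  have "mon [1] \<in> vecs"
    by (rule mon_in_vecs) (simp_all add: tails_Cons)
  hence "act f (mon [1]) = 0" by (rule act_ideal[OF f(2)])
  moreover have "act f (mon [1]) =
      (\<Sum>w\<in>Poly_Mapping.keys f. Poly_Mapping.single (Word (\<sigma> w)) (Poly_Mapping.lookup f w))"
    unfolding act_def lext_def using f(1)
    by (intro sum.cong) (auto simp: \<sigma>(2) single_eq_scl_mon)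
  ultimately have sum0: "(\<Sum>w\<in>Poly_Mapping.keys f.
      Poly_Mapping.single (Word (\<sigma> w)) (Poly_Mapping.lookup f w)) = 0" by simp
  have inj: "\<sigma> w = \<sigma> v \<longleftrightarrow> w = v" if "w \<in> Poly_Mapping.keys f" "v \<in> Poly_Mapping.keys f" for w v
    using that f(1) \<sigma>(1) by (metis fmon.expand subsetD)
  have "Poly_Mapping.lookup f v = 0" if v: "v \<in> Poly_Mapping.keys f" for v
  proof -
    have "0 = Poly_Mapping.lookup (\<Sum>w\<in>Poly_Mapping.keys f.
        Poly_Mapping.single (Word (\<sigma> w)) (Poly_Mapping.lookup f w)) (Word (\<sigma> v))"
      using sum0 by simp
    also have "\<dots> = (\<Sum>w\<in>Poly_Mapping.keys f. if w = v then Poly_Mapping.lookup f w else 0)"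
      unfolding lookup_sum using inj v
      by (intro sum.cong) (auto simp: lookup_single when_def)
    also have "\<dots> = Poly_Mapping.lookup f v" using v by simp
    finally show ?thesis by simp
  qed
  thus ?thesis by (metis in_keys_iff lookup_zero poly_mapping_eqI)
qed

end

section \<open>Reductions\<close>

lemma class_add_cong:
  assumes "inner_inverse_class scale p f = inner_inverse_class scale p f'"
    and "inner_inverse_class scale p g = inner_inverse_class scale p g'"
  shows "inner_inverse_class scale p (f + g) = inner_inverse_class scale p (f' + g')"
  using assms by (metis inner_inverse_class_simps(2))

lemma class_mult_cong:
  assumes "inner_inverse_class scale p f = inner_inverse_class scale p f'"
    and "inner_inverse_class scale p g = inner_inverse_class scale p g'"
  shows "inner_inverse_class scale p (f * g) = inner_inverse_class scale p (f' * g')"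
  using assms by (metis inner_inverse_class_simps(1))

lemma single_single_mult:
  "Poly_Mapping.single u c * Poly_Mapping.single w 1 * Poly_Mapping.single v 1 =
    Poly_Mapping.single (u + w + v) (c :: 'k::field)"
  by (simp add: mult_single)

lemma class_reduction_step:
  assumes "reduction_step Red g h"
    and "\<And>W f. (W, f) \<in> Red \<Longrightarrow> inner_inverse_class scale p (Poly_Mapping.single W 1) = inner_inverse_class scale p f"
  shows "inner_inverse_class scale p h = inner_inverse_class scale p g"
proof -
  obtain W f u v c where Wf: "(W, f) \<in> Red"
    and h: "h = g - Poly_Mapping.single (u + W + v) c
                 + Poly_Mapping.single u c * f * Poly_Mapping.single v 1"
    using assms(1) unfolding reduction_step_def Let_def by blast
  have "inner_inverse_class scale p h = inner_inverse_class scale p (g - Poly_Mapping.single (u + W + v) c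
      + Poly_Mapping.single u c * Poly_Mapping.single W 1 * Poly_Mapping.single v 1)"
    unfolding h by (intro class_add_cong class_mult_cong refl assms(2)[OF Wf, symmetric])
  thus ?thesis by (simp add: single_single_mult)
qed

lemma keys_reduction_step:
  assumes "reduction_step Red g h"
  obtains W f u v where "(W, f) \<in> Red" "u + W + v \<in> Poly_Mapping.keys g"
    "Poly_Mapping.keys h \<subseteq> (Poly_Mapping.keys g - {u + W + v}) \<union> (\<lambda>w. u + w + v) ` Poly_Mapping.keys f"
proof -
  obtain W f u v where Wf: "(W, f) \<in> Red" "u + W + v \<in> Poly_Mapping.keys g"
    and h: "h = g - Poly_Mapping.single (u + W + v) (Poly_Mapping.lookup g (u + W + v))
      + Poly_Mapping.single u (Poly_Mapping.lookup g (u + W + v)) * f * Poly_Mapping.single v 1"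
    using assms unfolding reduction_step_def Let_def by blast
  let ?g = "g - Poly_Mapping.single (u + W + v) (Poly_Mapping.lookup g (u + W + v))"
  let ?f = "Poly_Mapping.single u (Poly_Mapping.lookup g (u + W + v)) * f * Poly_Mapping.single v 1"
  have "Poly_Mapping.keys ?g \<subseteq> Poly_Mapping.keys g - {u + W + v}"
    by (auto simp: in_keys_iff lookup_minus lookup_single when_def split: if_splits)
  moreover have "Poly_Mapping.keys ?f \<subseteq> (\<lambda>w. u + w + v) ` Poly_Mapping.keys f"
    using keys_mult[of "Poly_Mapping.single u (Poly_Mapping.lookup g (u + W + v)) * f" "Poly_Mapping.single v 1"]
      keys_mult[of "Poly_Mapping.single u (Poly_Mapping.lookup g (u + W + v))" f]
    by (cases "Poly_Mapping.lookup g (u + W + v) = 0") (simp, simp, blast)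
  ultimately have "Poly_Mapping.keys h \<subseteq>
      (Poly_Mapping.keys g - {u + W + v}) \<union> (\<lambda>w. u + w + v) ` Poly_Mapping.keys f"
    unfolding h using Poly_Mapping.keys_add[of ?g ?f] by blast
  with Wf that show thesis by blast
qed

lemma words_over_plus: "u + v \<in> words_over G \<longleftrightarrow> u \<in> words_over G \<and> v \<in> words_over G"
  by (auto simp: words_over_def plus_fmon_def)

lemma words_over_reduction_step:
  assumes "reduction_step Red g h" "Poly_Mapping.keys g \<subseteq> words_over G"
    and "\<And>W f. (W, f) \<in> Red \<Longrightarrow> Poly_Mapping.keys f \<subseteq> words_over G"
  shows "Poly_Mapping.keys h \<subseteq> words_over G"
proof -
  obtain W f u v where *: "(W, f) \<in> Red" "u + W + v \<in> Poly_Mapping.keys g"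
    "Poly_Mapping.keys h \<subseteq> (Poly_Mapping.keys g - {u + W + v}) \<union> (\<lambda>w. u + w + v) ` Poly_Mapping.keys f"
    using assms(1) by (rule keys_reduction_step)
  have "u \<in> words_over G" "v \<in> words_over G"
    using *(2) assms(2) words_over_plus by blast+
  hence "(\<lambda>w. u + w + v) ` Poly_Mapping.keys f \<subseteq> words_over G"
    using assms(3)[OF *(1)] by (auto simp: words_over_plus)
  thus ?thesis using *(3) assms(2) by blast
qed

text \<open>A step may trade one word for many shorter ones, so neither the number of words nor
  their total length decreases; the multiset order on lengths does.\<close>

definition length_mset :: "('a fmon \<Rightarrow>\<^sub>0 'k::field) \<Rightarrow> nat multiset"
  where "length_mset f = image_mset (\<lambda>w. length (letters w)) (mset_set (Poly_Mapping.keys f))"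

lemma length_mset_reduction_step:
  assumes "reduction_step Red g h"
    and "\<And>W f w. (W, f) \<in> Red \<Longrightarrow> w \<in> Poly_Mapping.keys f \<Longrightarrow> length (letters w) < length (letters W)"
  shows "(length_mset h, length_mset g) \<in> mult less_than"
proof -
  obtain W f u v where *: "(W, f) \<in> Red" "u + W + v \<in> Poly_Mapping.keys g"
    "Poly_Mapping.keys h \<subseteq> (Poly_Mapping.keys g - {u + W + v}) \<union> (\<lambda>w. u + w + v) ` Poly_Mapping.keys f"
    using assms(1) by (rule keys_reduction_step)
  let ?l = "\<lambda>A. image_mset (\<lambda>w. length (letters w)) (mset_set A)"
  \<comment> \<open>The words that survive the step. All other words of \<open>h\<close> come from
    the replacement and are shorter than \<open>u + W + v\<close>; words of \<open>g\<close> that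
    cancel only enlarge the right-hand side.\<close>
  let ?I = "Poly_Mapping.keys h \<inter> (Poly_Mapping.keys g - {u + W + v})"
  have split: "?l A = ?l (A \<inter> C) + ?l (A - C)" if "finite A" for A C :: "'a fmon set"
  proof -
    have "mset_set A = mset_set (A \<inter> C) + mset_set (A - C)"
      using that mset_set_Union[of "A \<inter> C" "A - C"] by (simp add: Int_Diff_Un Int_Diff_disjoint)
    thus ?thesis by simp
  qed
  have "?l ?I + ?l (Poly_Mapping.keys h - ?I) = length_mset h"
    using split[of "Poly_Mapping.keys h" ?I] by (simp add: length_mset_def Int_absorb1)
  moreover have "?l ?I + ?l (Poly_Mapping.keys g - ?I) = length_mset g"
    using split[of "Poly_Mapping.keys g" ?I] by (simp add: length_mset_def inf.absorb2 le_infI2)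
  moreover have "(?l ?I + ?l (Poly_Mapping.keys h - ?I), ?l ?I + ?l (Poly_Mapping.keys g - ?I)) \<in> mult less_than"
  proof (rule one_step_implies_mult)
    have mem: "u + W + v \<in> Poly_Mapping.keys g - ?I" using *(2) by blast
    hence "length (letters (u + W + v)) \<in># ?l (Poly_Mapping.keys g - ?I)"
      using *(2) by simp
    moreover have "k < length (letters (u + W + v))" if "k \<in># ?l (Poly_Mapping.keys h - ?I)" for k
      using that *(3) assms(2)[OF *(1)] by (fastforce simp: plus_fmon_def)
    ultimately show "\<forall>k\<in>#?l (Poly_Mapping.keys h - ?I). \<exists>j\<in>#?l (Poly_Mapping.keys g - ?I). (k, j) \<in> less_than"
      by (metis less_than_iff)
    show "?l (Poly_Mapping.keys g - ?I) \<noteq> {#}" using mem by (auto simp: mset_set_empty_iff)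
  qed
  ultimately show ?thesis by simp
qed

lemma reduction_stepI:
  assumes "(W, f) \<in> Red" "w \<in> Poly_Mapping.keys g" "sublist (letters W) (letters w)"
  shows "\<exists>h. reduction_step Red g h"
proof -
  obtain us vs where "letters w = us @ letters W @ vs" using assms(3) by (auto simp: sublist_def)
  hence "w = Word us + W + Word vs" by (intro fmon.expand) (simp add: plus_fmon_def)
  thus ?thesis using assms(1,2) unfolding reduction_step_def Let_def by blast
qed

context adapted_basis
begin

section \<open>Expansion of elements of \<open>R\<close> in the basis\<close>

abbreviation basis_forms :: "'r gen fmon set"
  where "basis_forms \<equiv> insert 0 ((\<lambda>b. Word [El b]) ` B)"

abbreviation val :: "('r gen fmon \<Rightarrow>\<^sub>0 'k) \<Rightarrow> 'r"
  where "val \<equiv> eval_at scale (case_gen (\<lambda>x. x) 0)"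

abbreviation word_val :: "'r gen fmon \<Rightarrow> 'r"
  where "word_val w \<equiv> prod_list (map (case_gen (\<lambda>x. x) 0) (letters w))"

lemma word_val_basis_forms: "inj_on word_val basis_forms" "word_val ` basis_forms = insert 1 B"
proof -
  have [simp]: "word_val 0 = 1" "word_val (Word [El b]) = b" for b
    by (simp_all add: zero_fmon_def)
  show "word_val ` basis_forms = insert 1 B"
    by (simp only: image_insert image_image \<open>word_val 0 = 1\<close> \<open>\<And>b. word_val (Word [El b]) = b\<close> image_ident)
  show "inj_on word_val basis_forms"
  proof (rule inj_onI)
    fix v w assume "v \<in> basis_forms" "w \<in> basis_forms" "word_val v = word_val w"
    thus "v = w" using one_notin by (elim insertE imageE) simp_all
  qed
qed

lemma val_eq_0:
  assumes "Poly_Mapping.keys f \<subseteq> basis_forms" "val f = 0"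
  shows "f = 0"
proof -
  let ?K = "Poly_Mapping.keys f"
  have inj: "inj_on word_val ?K" using word_val_basis_forms(1) assms(1) by (rule inj_on_subset)
  have sum: "(\<Sum>b\<in>word_val ` ?K. scale (Poly_Mapping.lookup f (the_inv_into ?K word_val b)) b) = 0"
    using assms(2) unfolding eval_at_def sum.reindex[OF inj] comp_def
    by (simp add: the_inv_into_f_f[OF inj] cong: sum.cong)
  have subset: "word_val ` ?K \<subseteq> insert 1 B"
    unfolding word_val_basis_forms(2)[symmetric] using assms(1) by (rule image_mono)
  have "Poly_Mapping.lookup f (the_inv_into ?K word_val (word_val w)) = 0" if "w \<in> ?K" for w
    by (rule independentD[OF independent_basis _ subset sum]) (use that in simp_all)
  hence "Poly_Mapping.lookup f w = 0" if "w \<in> ?K" for w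
    using that by (simp add: the_inv_into_f_f[OF inj])
  thus ?thesis by (metis in_keys_iff lookup_zero poly_mapping_eqI)
qed

lemma val_add: "val (f + g) = val f + val g"
  by (rule eval_at_add) unfold_locales

lemma val_single: "val (Poly_Mapping.single w c) = scale c (word_val w)"
  by (rule eval_at_single) unfold_locales

lemma val_mult: "val (f * g) = val f * val g"
  by (rule eval_at_mult) unfold_locales

lemma val_surj: "\<exists>f. Poly_Mapping.keys f \<subseteq> basis_forms \<and> val f = r"
proof -
  let ?E = "{r. \<exists>f. Poly_Mapping.keys f \<subseteq> basis_forms \<and> val f = r}"
  have "span (insert 1 B) \<subseteq> ?E"
  proof (rule span_minimal)
    show "insert 1 B \<subseteq> ?E"
    proof
      fix b assume "b \<in> insert 1 B"
      hence "b \<in> word_val ` basis_forms" by (simp only: word_val_basis_forms(2))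
      then obtain w where w: "b = word_val w" "w \<in> basis_forms" by (rule imageE)
      have "val (Poly_Mapping.single w 1) = b" unfolding val_single w(1) by (rule scale_one)
      moreover have "Poly_Mapping.keys (Poly_Mapping.single w (1::'k)) \<subseteq> basis_forms" using w(2) by simp
      ultimately show "b \<in> ?E" by blast
    qed
    show "subspace ?E"
    proof (rule subspaceI)
      show "0 \<in> ?E" by (intro CollectI exI[of _ 0]) (simp add: eval_at_def)
    next
      fix x y assume "x \<in> ?E" "y \<in> ?E"
      then obtain f g where fg: "Poly_Mapping.keys f \<subseteq> basis_forms" "val f = x"
          "Poly_Mapping.keys g \<subseteq> basis_forms" "val g = y" by blast
      hence "val (f + g) = x + y" by (simp add: val_add)
      moreover have "Poly_Mapping.keys (f + g) \<subseteq> basis_forms"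
        using fg Poly_Mapping.keys_add[of f g] by blast
      ultimately show "x + y \<in> ?E" by blast
    next
      fix c x assume "x \<in> ?E"
      then obtain f where "Poly_Mapping.keys f \<subseteq> basis_forms" "val f = x" by blast
      moreover have "val (scl c f) = scale c (val f)"
        unfolding val_mult by (simp add: scalar_def val_single scale_mult_left zero_fmon_def)
      ultimately have "val (scl c f) = scale c x" "Poly_Mapping.keys (scl c f) \<subseteq> basis_forms"
        using keys_scl[of c f] by (simp, blast)
      thus "scale c x \<in> ?E" by blast
    qed
  qed
  thus ?thesis using span_basis by blast
qed

text \<open>Linear independence and spanning of \<open>insert 1 B\<close> give the unique existence
  that the \<open>THE\<close> in \<open>R_form\<close> relies on.\<close>

lemma R_form:
  "Poly_Mapping.keys (R_form scale B r) \<subseteq> basis_forms" "val (R_form scale B r) = r"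
proof -
  have "\<exists>!f. Poly_Mapping.keys f \<subseteq> basis_forms \<and> val f = r"
  proof (rule ex_ex1I[OF val_surj])
    fix f g assume fg: "Poly_Mapping.keys f \<subseteq> basis_forms \<and> val f = r" "Poly_Mapping.keys g \<subseteq> basis_forms \<and> val g = r"
    have "Poly_Mapping.keys (f - g) \<subseteq> Poly_Mapping.keys f \<union> Poly_Mapping.keys g"
      by (auto simp: in_keys_iff lookup_minus)
    moreover have "val (f - g) = 0" using fg val_add[of "f - g" g] by simp
    ultimately have "f - g = 0" using fg by (intro val_eq_0) blast+
    thus "f = g" by simp
  qed
  from theI'[OF this]
  show "Poly_Mapping.keys (R_form scale B r) \<subseteq> basis_forms" "val (R_form scale B r) = r"
    unfolding R_form_def by blast+
qed

abbreviation cl :: "('r gen fmon \<Rightarrow>\<^sub>0 'k) \<Rightarrow> ('r gen fmon \<Rightarrow>\<^sub>0 'k) set"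
  where "cl \<equiv> inner_inverse_class scale p"

text \<open>The presentation has a generator for each element of \<open>R\<close>, so the relators
  for sums and scalars fold a whole combination into one generator; the empty word enters as
  \<open>El 1\<close>.\<close>

lemma class_mon_El_val:
  assumes "Poly_Mapping.keys f \<subseteq> basis_forms"
  shows "cl f = cl (mon [El (val f)])"
proof -
  have single: "cl (Poly_Mapping.single w c) = cl (mon [El (scale c (word_val w))])"
    if "w \<in> basis_forms" for w c
  proof -
    have "cl (mon (letters w)) = cl (mon [El (word_val w)])"
    proof (cases "w = 0")
      case True
      have "mon [] = (1 :: 'r gen fmon \<Rightarrow>\<^sub>0 'k)" by (simp add: mon_def zero_fmon_def[symmetric])
      thus ?thesis using True inner_inverse_relators_class(4)[of scale p] by (simp add: zero_fmon_def)
    qed (use that in auto)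
    hence "cl (scl c (mon (letters w))) = cl (scl c (mon [El (word_val w)]))"
      by (intro class_mult_cong refl)
    thus ?thesis
      by (simp add: single_eq_scl_mon inner_inverse_relators_class(2))
  qed
  have "cl (\<Sum>w\<in>A. Poly_Mapping.single w (Poly_Mapping.lookup f w)) =
      cl (mon [El (\<Sum>w\<in>A. scale (Poly_Mapping.lookup f w) (word_val w))])"
    if "finite A" "A \<subseteq> basis_forms" for A
    using that
  proof (induction rule: finite_induct)
    case empty
    show ?case using single[of 0 0] by (simp add: scale_zero_left)
  next
    case (insert w A)
    thus ?case
      using class_add_cong[OF single[of w "Poly_Mapping.lookup f w"] insert.IH]
      by (simp add: inner_inverse_relators_class(1))
  qed
  from this[OF finite_keys assms] show ?thesis
    by (simp add: sum_single_lookup eval_at_def)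
qed

lemma class_R_form: "cl (R_form scale B r) = cl (mon [El r])"
  using class_mon_El_val[OF R_form(1)[of r]] R_form(2)[of r] by simp

section \<open>The two systems of reductions\<close>

abbreviation G :: "'r gen set" where "G \<equiv> El ` B \<union> {Adj}"

abbreviation N :: "'r gen fmon set" where "N \<equiv> normal_words B L M"

abbreviation Red :: "('r gen fmon \<times> ('r gen fmon \<Rightarrow>\<^sub>0 'k)) set"
  where "Red \<equiv> inner_inverse_reductions scale p B L M"

lemma basis_forms_over: "basis_forms \<subseteq> words_over G"
  by (auto simp: words_over_def zero_fmon_def)

lemma class_sandwich: "cl (mon [El (x * p), Adj, El (p * y)]) = cl (mon [El (x * p * y)])"
proof -
  have mult: "cl (mon [El (a * b)]) = cl (mon [El a] * mon [El b])" for a b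
    using inner_inverse_relators_class(3)[of scale p a b] by (simp add: mon_append[symmetric])
  have "cl (mon [El (x * p), Adj, El (p * y)]) = cl (mon [El (x * p)] * mon [Adj] * mon [El (p * y)])"
    by (simp add: mon_append[symmetric])
  also have "\<dots> = cl (mon [El x] * mon [El p] * mon [Adj] * (mon [El p] * mon [El y]))"
    by (intro class_mult_cong mult refl)
  also have "mon [El x] * mon [El p] * mon [Adj] * (mon [El p] * mon [El y]) =
      mon [El x] * mon [El p, Adj, El p] * mon [El y]"
    by (simp add: mon_append[symmetric])
  also have "cl \<dots> = cl (mon [El x] * mon [El p] * mon [El y])"
    by (intro class_mult_cong refl inner_inverse_relators_class(5))
  also have "\<dots> = cl (mon [El (x * p)] * mon [El y])"
    by (intro class_mult_cong refl mult[symmetric])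
  also have "\<dots> = cl (mon [El (x * p * y)])" by (rule mult[symmetric])
  finally show ?thesis .
qed

lemma reduction_facts:
  assumes "(W, f) \<in> Red"
  shows "W \<in> words_over G" "Poly_Mapping.keys f \<subseteq> words_over G"
    "cl (Poly_Mapping.single W 1) = cl f"
    "w \<in> Poly_Mapping.keys f \<Longrightarrow> length (letters w) < length (letters W)"
proof -
  have form: "Poly_Mapping.keys (R_form scale B r) \<subseteq> words_over G" for r
    using R_form(1) basis_forms_over by (rule subset_trans)
  \<comment> \<open>Termination rests on this bound: right-hand sides consist of words of length at
    most 1, while left-hand sides have length 2 or 3.\<close>
  have len: "length (letters w) \<le> 1" if "w \<in> Poly_Mapping.keys (R_form scale B r)" for w r
    using that R_form(1)[of r] by (auto simp: zero_fmon_def)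
  show "W \<in> words_over G"
    using assms L_subset M_subset by (auto simp: inner_inverse_reductions_def words_over_def; blast)
  show "Poly_Mapping.keys f \<subseteq> words_over G"
    using assms form by (auto simp: inner_inverse_reductions_def)
  show "cl (Poly_Mapping.single W 1) = cl f"
    using assms unfolding inner_inverse_reductions_def
  proof (elim UnE CollectE exE conjE Pair_inject)
    fix x y assume "W = Word [El x, El y]" "f = R_form scale B (x * y)"
    thus ?thesis by (simp only: mon_def[symmetric] class_R_form inner_inverse_relators_class(3))
  next
    fix x y assume "W = Word [El (x * p), Adj, El (p * y)]" "f = R_form scale B (x * p * y)"
    thus ?thesis by (simp only: mon_def[symmetric] class_R_form class_sandwich)
  qed
  show "length (letters w) < length (letters W)" if "w \<in> Poly_Mapping.keys f"
  proof -
    obtain r where "f = R_form scale B r"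
      using assms by (auto simp: inner_inverse_reductions_def)
    hence "length (letters w) \<le> 1" using that len by simp
    moreover have "length (letters W) \<ge> 2"
      using assms by (auto simp: inner_inverse_reductions_def)
    ultimately show ?thesis by simp
  qed
qed

lemma irreducible_normal:
  assumes "Poly_Mapping.keys h \<subseteq> words_over G" "\<not> (\<exists>h'. reduction_step Red h h')"
  shows "Poly_Mapping.keys h \<subseteq> N"
proof
  fix w assume w: "w \<in> Poly_Mapping.keys h"
  have "\<not> sublist [El x, El y] (letters w)" if "x \<in> B" "y \<in> B" for x y
  proof
    have "(Word [El x, El y], R_form scale B (x * y)) \<in> Red"
      using that by (auto simp: inner_inverse_reductions_def)
    moreover assume "sublist [El x, El y] (letters w)"
    ultimately show False using reduction_stepI[OF _ w] assms(2) by fastforce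
  qed
  moreover have "\<not> sublist [El u, Adj, El v] (letters w)" if uv: "u \<in> L" "v \<in> M" for u v
  proof
    \<comment> \<open>The reductions are indexed by factors \<open>x\<close> and \<open>y\<close>,
      so the letters \<open>u\<close> and \<open>v\<close> are first written as multiples of
      \<open>p\<close>.\<close>
    obtain x y where xy: "u = x * p" "v = p * y"
      using span_base[OF uv(1)] span_base[OF uv(2)] unfolding span_L span_M by blast
    have "(Word [El u, Adj, El v], R_form scale B (x * p * y)) \<in> Red"
      using uv unfolding xy inner_inverse_reductions_def by blast
    moreover assume "sublist [El u, Adj, El v] (letters w)"
    ultimately show False using reduction_stepI[OF _ w] assms(2) by fastforce
  qed
  ultimately show "w \<in> N" using w assms(1) by (auto simp: normal_words_def)
qed

lemma reduction_step_props:
  assumes "reduction_step Red g h"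
  shows "cl h = cl g" "(length_mset h, length_mset g) \<in> mult less_than"
    "Poly_Mapping.keys g \<subseteq> words_over G \<Longrightarrow> Poly_Mapping.keys h \<subseteq> words_over G"
  by (rule class_reduction_step[OF assms reduction_facts(3)] length_mset_reduction_step[OF assms reduction_facts(4)]
      words_over_reduction_step[OF assms _ reduction_facts(2)]; assumption)+

lemma reductions_props:
  assumes "(reduction_step Red)\<^sup>*\<^sup>* g h" "Poly_Mapping.keys g \<subseteq> words_over G"
  shows "cl h = cl g" "Poly_Mapping.keys h \<subseteq> words_over G"
proof -
  have "cl h = cl g \<and> Poly_Mapping.keys h \<subseteq> words_over G"
    using assms
  proof (induction rule: rtranclp_induct)
    case (step h h')
    thus ?case using reduction_step_props(1,3)[OF step.hyps(2)] by simp
  qed simp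
  thus "cl h = cl g" "Poly_Mapping.keys h \<subseteq> words_over G" by simp_all
qed

lemma exists_irreducible:
  "\<exists>h. (reduction_step Red)\<^sup>*\<^sup>* g h \<and> \<not> (\<exists>h'. reduction_step Red h h')"
proof (induction g rule: wf_induct_rule[OF wf_inv_image[OF wf_mult[OF wf_less_than], of length_mset]])
  case (1 g)
  show ?case
  proof (cases "\<exists>h. reduction_step Red g h")
    case True
    then obtain h where h: "reduction_step Red g h" by blast
    have "(h, g) \<in> inv_image (mult less_than) length_mset"
      using reduction_step_props(2)[OF h] by (simp add: inv_image_def)
    from 1[OF this] h show ?thesis by (meson converse_rtranclp_into_rtranclp)
  qed blast
qed

text \<open>The presentation has generators for all of \<open>R\<close>, the normal forms only
  letters of \<open>B\<close>. Replacing every \<open>El r\<close> in a word by the expansion of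
  \<open>r\<close> bridges the two.\<close>

lemma class_eq_over: "\<exists>g. Poly_Mapping.keys g \<subseteq> words_over G \<and> cl g = cl f"
proof (induction f rule: free_algebra_induct)
  case (single w c)
  have mon: "\<exists>g. Poly_Mapping.keys g \<subseteq> words_over G \<and> cl g = cl (mon ws)" for ws
  proof (induction ws)
    case Nil
    show ?case by (rule exI[of _ "mon []"]) (simp add: mon_def words_over_def)
  next
    case (Cons x ws)
    then obtain g where g: "Poly_Mapping.keys g \<subseteq> words_over G" "cl g = cl (mon ws)" by blast
    obtain e where e: "Poly_Mapping.keys e \<subseteq> words_over G" "cl e = cl (mon [x])"
    proof (cases x)
      case (El r)
      show thesis
        by (rule that[OF subset_trans[OF R_form(1)[of r] basis_forms_over]]) (simp add: El class_R_form)
    next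
      case Adj
      have "Poly_Mapping.keys (mon [Adj] :: 'r gen fmon \<Rightarrow>\<^sub>0 'k) \<subseteq> words_over G"
        by (simp add: mon_def words_over_def)
      thus thesis by (rule that) (simp add: Adj)
    qed
    have "Poly_Mapping.keys (e * g) \<subseteq> words_over G"
      using keys_mult[of e g] e(1) g(1) by (force simp: words_over_plus)
    moreover have "cl (e * g) = cl (mon (x # ws))"
      using class_mult_cong[OF e(2) g(2)] by (simp add: mon_append[symmetric])
    ultimately show ?case by (intro exI[of _ "e * g"] conjI)
  qed
  obtain g where g: "Poly_Mapping.keys g \<subseteq> words_over G" "cl g = cl (mon (letters w))"
    using mon[of "letters w"] by (elim exE conjE)
  have "Poly_Mapping.keys (scl c g) \<subseteq> words_over G" using keys_scl g(1) by (rule subset_trans)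
  moreover have "cl (scl c g) = cl (Poly_Mapping.single w c)"
    unfolding single_eq_scl_mon by (intro class_mult_cong g(2) refl)
  ultimately show ?case by (intro exI[of _ "scl c g"] conjI)
next
  case (add f g)
  then obtain f' g' where fg: "Poly_Mapping.keys f' \<subseteq> words_over G" "cl f' = cl f"
      "Poly_Mapping.keys g' \<subseteq> words_over G" "cl g' = cl g" by (elim exE conjE)
  have "Poly_Mapping.keys (f' + g') \<subseteq> words_over G"
    using Poly_Mapping.keys_add[of f' g'] fg(1,3) by blast
  thus ?case
    using class_add_cong[OF fg(2,4)] by (intro exI[of _ "f' + g'"] conjI)
qed

section \<open>Normal forms and the resulting basis\<close>

lemma normal_form_exists: "\<exists>h. Poly_Mapping.keys h \<subseteq> N \<and> cl h = cl f"
proof -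
  obtain g where g: "Poly_Mapping.keys g \<subseteq> words_over G" "cl g = cl f"
    using class_eq_over by blast
  obtain h where "(reduction_step Red)\<^sup>*\<^sup>* g h" "\<not> (\<exists>h'. reduction_step Red h h')"
    using exists_irreducible by blast
  thus ?thesis using reductions_props[of g h] irreducible_normal[of h] g by auto
qed

lemma normal_form_unique:
  assumes "Poly_Mapping.keys h \<subseteq> N" "Poly_Mapping.keys h' \<subseteq> N" "cl h = cl h'"
  shows "h = h'"
proof -
  have "Poly_Mapping.keys (h - h') \<subseteq> Poly_Mapping.keys h \<union> Poly_Mapping.keys h'"
    by (auto simp: in_keys_iff lookup_minus)
  hence "h - h' = 0"
    using assms by (intro normal_words_independent) (auto simp: inner_inverse_class_eq_iff)
  thus ?thesis by simp
qed

lemma reduces_to_normal_form: "reduces_to_normal_form G N cl Red"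
  unfolding reduces_to_normal_form_def
proof (intro conjI allI impI)
  show "\<forall>(W, f)\<in>Red. W \<in> words_over G \<and> Poly_Mapping.keys f \<subseteq> words_over G \<and>
       cl (Poly_Mapping.single W 1) = cl f"
    using reduction_facts by blast
next
  fix g :: "'r gen fmon \<Rightarrow>\<^sub>0 'k" assume g: "Poly_Mapping.keys g \<subseteq> words_over G"
  show "\<exists>!h. Poly_Mapping.keys h \<subseteq> N \<and> cl h = cl g"
  proof (rule ex_ex1I[OF normal_form_exists])
    fix h h' assume "Poly_Mapping.keys h \<subseteq> N \<and> cl h = cl g" "Poly_Mapping.keys h' \<subseteq> N \<and> cl h' = cl g"
    thus "h = h'" by (intro normal_form_unique) auto
  qed
  show "\<not> (\<exists>s. s 0 = g \<and> (\<forall>i. reduction_step Red (s i) (s (Suc i))))"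
  proof
    assume "\<exists>s. s 0 = g \<and> (\<forall>i. reduction_step Red (s i) (s (Suc i)))"
    then obtain s where "\<And>i. reduction_step Red (s i) (s (Suc i))" by blast
    hence "(length_mset (s (Suc i)), length_mset (s i)) \<in> mult less_than" for i
      using reduction_step_props(2) by blast
    hence "\<exists>f. \<forall>i. (f (Suc i), f i) \<in> mult less_than"
      by (intro exI[of _ "\<lambda>i. length_mset (s i)"] allI)
    thus False
      using wf_mult[OF wf_less_than, unfolded wf_iff_no_infinite_down_chain] by contradiction
  qed
  fix h assume h: "(reduction_step Red)\<^sup>*\<^sup>* g h \<and> \<not> (\<exists>h'. reduction_step Red h h')"
  show "Poly_Mapping.keys h \<subseteq> N" "cl h = cl g"
    using h reductions_props[of g h] g irreducible_normal by blast+
qed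

lemma normal_words_basis: "gives_basis (inner_inverse_algebra scale p) cl N"
proof -
  let ?\<pi> = "\<lambda>w. cl (Poly_Mapping.single w 1)"
  let ?S = "inner_inverse_algebra scale p"
  interpret S: vectorspace ring_of_type_algebra ?S
    by (rule vectorspace_inner_inverse_algebra)
  have inj: "inj_on ?\<pi> N"
  proof (rule inj_onI)
    fix w v assume "w \<in> N" "v \<in> N" "?\<pi> w = ?\<pi> v"
    hence "Poly_Mapping.single w (1::'k) = Poly_Mapping.single v 1"
      by (intro normal_form_unique) simp_all
    thus "w = v" by (metis keys_single singleton_inject zero_neq_one)
  qed
  have carrier: "cl f \<in> carrier ?S" for f
    by (simp add: carrier_inner_inverse_algebra)
  have lincomb: "S.lincomb a (?\<pi> ` W) = cl (\<Sum>w\<in>W. Poly_Mapping.single w (a (?\<pi> w)))"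
    if "finite W" "W \<subseteq> N" for a W
    using that
  proof (induction rule: finite_induct)
    case empty
    show ?case by (simp add: S.lincomb_def inner_inverse_class_simps)
  next
    case (insert w W)
    have "?\<pi> w \<notin> ?\<pi> ` W" using insert inj by (auto simp: inj_on_def)
    hence "S.lincomb a (?\<pi> ` insert w W) =
        a (?\<pi> w) \<odot>\<^bsub>?S\<^esub> ?\<pi> w \<oplus>\<^bsub>?S\<^esub> S.lincomb a (?\<pi> ` W)"
      unfolding S.lincomb_def image_insert using insert.hyps(1)
      by (intro S.finsum_insert) (auto simp: carrier inner_inverse_class_simps)
    also have "a (?\<pi> w) \<odot>\<^bsub>?S\<^esub> ?\<pi> w = cl (Poly_Mapping.single w (a (?\<pi> w)))"
      by (simp add: inner_inverse_class_simps scalar_mult_single)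
    finally show ?case
      using insert by (simp add: inner_inverse_class_simps)
  qed
  have "S.lin_indpt (?\<pi> ` N)"
    unfolding S.lin_dep_def
  proof clarify
    fix A a v assume *: "finite A" "A \<subseteq> ?\<pi> ` N" "S.lincomb a A = \<zero>\<^bsub>?S\<^esub>" "v \<in> A"
      "a v \<noteq> \<zero>\<^bsub>ring_of_type_algebra\<^esub>"
    obtain W where W: "finite W" "W \<subseteq> N" "A = ?\<pi> ` W"
      using finite_subset_image[OF *(1,2)] by blast
    let ?f = "\<Sum>w\<in>W. Poly_Mapping.single w (a (?\<pi> w))"
    have lookup: "Poly_Mapping.lookup ?f w = (if w \<in> W then a (?\<pi> w) else 0)" for w
      using W(1) by (simp add: lookup_sum lookup_single when_def)
    have "Poly_Mapping.keys ?f \<subseteq> N"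
      using W(2) by (auto simp: in_keys_iff lookup split: if_splits)
    hence "?f = 0"
      using *(3) W by (intro normal_form_unique) (simp_all add: lincomb inner_inverse_class_simps)
    hence "a (?\<pi> w) = 0" if "w \<in> W" for w
      using that lookup[of w] by simp
    thus False using *(4,5) W(3) by auto
  qed
  moreover have "S.gen_set (?\<pi> ` N)"
  proof
    show "S.span (?\<pi> ` N) \<subseteq> carrier ?S" by (rule S.span_is_subset2) (auto simp: carrier)
    show "carrier ?S \<subseteq> S.span (?\<pi> ` N)"
    proof
      fix x assume "x \<in> carrier ?S"
      then obtain f where "x = cl f" by (auto simp: carrier_inner_inverse_algebra)
      then obtain h where h: "Poly_Mapping.keys h \<subseteq> N" "x = cl h"
        using normal_form_exists by metis
      \<comment> \<open>Coefficients in \<open>lincomb\<close> are indexed by classes; injectivity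
        lets each class be traced back to its normal word.\<close>
      let ?a = "\<lambda>x. Poly_Mapping.lookup h (the_inv_into N ?\<pi> x)"
      have "S.lincomb ?a (?\<pi> ` Poly_Mapping.keys h) =
          cl (\<Sum>w\<in>Poly_Mapping.keys h. Poly_Mapping.single w (Poly_Mapping.lookup h w))"
        using h(1) by (subst lincomb) (auto intro!: arg_cong[of _ _ cl] sum.cong simp: the_inv_into_f_f[OF inj])
      hence "x = S.lincomb ?a (?\<pi> ` Poly_Mapping.keys h)"
        using h(2) by (simp add: sum_single_lookup)
      moreover have "finite (?\<pi> ` Poly_Mapping.keys h)" "?\<pi> ` Poly_Mapping.keys h \<subseteq> ?\<pi> ` N"
        using h(1) by auto
      ultimately show "x \<in> S.span (?\<pi> ` N)"
        unfolding S.span_def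
        by (intro CollectI exI[of _ ?a] exI[of _ "?\<pi> ` Poly_Mapping.keys h"]) (simp add: Pi_def)
    qed
  qed
  ultimately show ?thesis
    unfolding gives_basis_def S.basis_def using inj carrier by auto
qed

end

section \<open>The four-part basis as an adapted basis\<close>

theorem theorem4:
  fixes scale :: "'k::field \<Rightarrow> 'r::ring_1 \<Rightarrow> 'r"
    and p :: 'r
    and Bpp Bpm Bmp Bmm B :: "'r set"
  assumes "k_algebra scale"
    and "1 \<notin> {p * x + y * p |x y. True}"
    and "is_basis scale (right_mults p \<inter> left_mults p) Bpp"
    and "p \<noteq> 0 \<longrightarrow> p \<in> Bpp"
    and "is_rel_basis scale (right_mults p \<inter> left_mults p) (right_mults p) Bpm"
    and "is_rel_basis scale (right_mults p \<inter> left_mults p) (left_mults p) Bmp"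
    and "is_rel_basis scale {p * x + y * p + scale c 1 |x y c. True} UNIV Bmm"
    and "B = Bpp \<union> Bpm \<union> Bmp \<union> Bmm"
  shows "is_basis scale UNIV (insert 1 B)
    \<and> gives_basis (inner_inverse_algebra scale p) (inner_inverse_class scale p)
        (normal_words B (Bpp \<union> Bmp) (Bpp \<union> Bpm))
    \<and> reduces_to_normal_form (El ` B \<union> {Adj})
        (normal_words B (Bpp \<union> Bmp) (Bpp \<union> Bpm))
        (inner_inverse_class scale p)
        (inner_inverse_reductions scale p B (Bpp \<union> Bmp) (Bpp \<union> Bpm))"
proof -
  interpret k_algebra scale by fact
  let ?L = "Bpp \<union> Bmp" and ?M = "Bpp \<union> Bpm"
  let ?D = "insert 1 (?M \<union> Bmp)"
  let ?U = "{p * x + y * p + scale c 1 |x y c. True}"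
  note Rp = subspace_left_mults[of p] and pR = subspace_right_mults[of p]
  have I: "subspace (right_mults p \<inter> left_mults p)" using pR Rp by (rule subspace_inter)
  have Bpp: "independent Bpp" "span Bpp = right_mults p \<inter> left_mults p"
    using assms(3) by (simp_all add: is_basis_def)
  have L: "span ?L = left_mults p"
    by (rule rel_basis_extend[OF assms(6) I Rp _ Bpp]) blast
  have M: "independent ?M" "span ?M = right_mults p"
    by (rule rel_basis_extend[OF assms(5) I pR _ Bpp], blast)+
  \<comment> \<open>The subspace relative to which \<open>Bmp\<close> is a basis is the intersection
    of \<open>span ?M = pR\<close> with \<open>Rp\<close>.\<close>
  have MB: "independent (?M \<union> Bmp)"
    by (rule independent_Un_rel_basis[OF M assms(6) Rp])
  have span_MB: "span (?M \<union> Bmp) = {p * x + y * p |x y. True}"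
  proof -
    have "?M \<union> Bmp = ?M \<union> ?L" by blast
    hence "span (?M \<union> Bmp) = {x + y |x y. x \<in> span ?M \<and> y \<in> span ?L}"
      by (simp only: span_Un[of ?M ?L])
    also have "\<dots> = {p * x + y * p |x y. True}" unfolding L M(2) by blast
    finally show ?thesis .
  qed
  have D: "independent ?D" using assms(2) MB unfolding span_MB[symmetric] by (rule independent_insertI)
  have span_D: "span ?D = ?U"
  proof -
    have "z \<in> span ?D \<longleftrightarrow> z \<in> ?U" for z
    proof -
      have "z \<in> span ?D \<longleftrightarrow> (\<exists>c x y. z - scale c 1 = p * x + y * p)"
        unfolding span_insert span_MB by simp
      also have "\<dots> \<longleftrightarrow> (\<exists>x y c. z = p * x + y * p + scale c 1)"
        unfolding diff_eq_eq by (iprover)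
      finally show ?thesis by simp
    qed
    thus ?thesis by blast
  qed
  have U: "subspace ?U" using subspace_span[of ?D] unfolding span_D .
  have B_split: "insert 1 B = ?D \<union> Bmm" unfolding assms(8) by blast
  have B: "independent (insert 1 B)" "span (insert 1 B) = UNIV"
    unfolding B_split by (rule rel_basis_extend[OF assms(7) U subspace_UNIV subset_UNIV D span_D])+
  \<comment> \<open>Independence of the set \<open>insert 1 B\<close> does not exclude
    \<open>1\<close> from \<open>B\<close>, so this is shown separately.\<close>
  have "1 \<notin> Bmm"
  proof
    assume "1 \<in> Bmm"
    moreover have "1 \<in> ?U" unfolding span_D[symmetric] by (rule span_base) simp
    hence "(\<Sum>b\<in>{1}. scale 1 b) \<in> ?U" by (simp only: sum.insert finite.emptyI empty_iff sum.empty
      scale_one add_0_right not_False_eq_True)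
    \<comment> \<open>The combination \<open>1 * 1\<close> of the one-element set lies in
      \<open>?U\<close>, so independence of \<open>Bmm\<close> relative to \<open>?U\<close> would
      force its coefficient to vanish.\<close>
    ultimately have "(1::'k) = 0"
      by (intro rel_basis_coeff_zero[OF assms(7) U subspace_UNIV, of "{1}" "\<lambda>_. 1" 1]) simp_all
    thus False by simp
  qed
  moreover have "1 \<notin> ?M \<union> Bmp"
    using assms(2) span_base[of 1 "?M \<union> Bmp"] unfolding span_MB by blast
  ultimately have one: "1 \<notin> B" unfolding assms(8) by blast
  interpret adapted_basis scale p B ?L ?M
  proof unfold_locales
    show "p \<noteq> 0 \<Longrightarrow> p \<in> ?L" using assms(4) by blast
    show "?L \<subseteq> B" "?M \<subseteq> B" unfolding assms(8) by blast+
  qed (rule B one L M(2))+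
  show ?thesis
    unfolding is_basis_def using B normal_words_basis reduces_to_normal_form by (intro conjI)
qed

end
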